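(* Take $t$ with $\mathrm{Im}(t)\neq0$ and consider a ray $l$ (from $0$) not equal to any of the BPS rays $\{\pm i\mathbb{R}_-(t+n)\}_{n\in\mathbb{Z}}\cup i\mathbb{R}_\pm$. Let $S_l$ be any sector containing $l$ and no BPS rays. Then there is $k>0$ such that $$|\lambda|^{-k}<|\mathcal X_{\beta^\vee}(t,\lambda)|<|\lambda|^{k}\quad\text{as }\lambda\to\infty,\ \lambda\in S_l$$ (i.e. for all $\lambda\in S_l$ with $|\lambda|$ sufficiently large).
   Context: For $t$ with $\mathrm{Im}(t)\ne0$ and $\lambda\in\mathbb{C}^\times$ away from the BPS rays define $$I_n(t,\lambda):=-\frac{\lambda}{\pi i}\int_{i\mathbb{R}_-(t+n)}\frac{d\lambda'}{(\lambda')^2-\lambda^2}\log\big(1-e^{2\pi i(t+n)/\lambda'}\big),\qquad n\in\mathbb{Z},$$ the contour being the ray $i\mathbb{R}_-(t+n)=\{-i(t+n)s:s>0\}$ oriented from $0$ to $\infty$ (on which $e^{2\pi i(t+n)/\lambda'}=e^{-2\pi/s}\in(0,1)$), and $$\mathcal X_{\beta^\vee}(t,\lambda):=\exp\Big(\frac{2\pi iZ_{\beta^\vee}(t)}{\lambda}\Big)\,\mathcal X^{\mathrm{inst}}_{\beta^\vee}(t,\lambda),\qquad \log\mathcal X^{\mathrm{inst}}_{\beta^\vee}(t,\lambda):=I_0(t,\lambda)+\sum_{n>0}\big[I_n(t,\lambda)+I_{-n}(t,\lambda)\big],$$ a convergent (symmetrically summed) series. Here $Z_{\beta^\vee}(t)=-\frac1{(2\pi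 i)^2}\big(\frac12(\log e^{2\pi it})^2+\mathrm{Li}_2(e^{2\pi it})\big)$ (principal branches, or any fixed branch where these are discontinuous). Sectors have apex at $0$. *)

theory Defs
  imports "HOL-Complex_Analysis.Complex_Analysis"
begin

definition ray :: "complex \<Rightarrow> complex set" where
  "ray v = {of_real s * v | s. s > 0}"

(* Sectors with apex 0 (apex excluded). Open, half-open and closed ranges of angles are all
   admitted; degenerate ranges (a single ray) are not. *)
definition is_sector :: "complex set \<Rightarrow> bool" where
  "is_sector S \<longleftrightarrow>
     (\<exists>J a. is_interval J \<and> interior J \<noteq> {} \<and> J \<subseteq> {a..a + 2 * pi} \<and>
        S = {of_real r * cis \<theta> | r \<theta>. r > 0 \<and> \<theta> \<in> J})"

definition bps_rays :: "complex \<Rightarrow> complex set set" where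
  "bps_rays t =
     range (\<lambda>n::int. ray (\<i> * (t + of_int n))) \<union>
     range (\<lambda>n::int. ray (- \<i> * (t + of_int n))) \<union>
     {ray \<i>, ray (- \<i>)}"

(* The integral of f along ray v, oriented from 0 to infinity. *)
definition ray_integral :: "complex \<Rightarrow> (complex \<Rightarrow> complex) \<Rightarrow> complex" where
  "ray_integral v f = (LINT s:{0<..}|lborel. f (of_real s * v) * v)"

definition I_BPS :: "complex \<Rightarrow> complex \<Rightarrow> int \<Rightarrow> complex" where
  "I_BPS t z n =
     - (z / (of_real pi * \<i>)) *
       ray_integral (- \<i> * (t + of_int n))
         (\<lambda>w. Ln (1 - exp (2 * of_real pi * \<i> * (t + of_int n) / w)) / (w\<^sup>2 - z\<^sup>2))"

definition log_X_inst :: "complex \<Rightarrow> complex \<Rightarrow> complex" where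
  "log_X_inst t z =
     I_BPS t z 0 + (\<Sum>n. I_BPS t z (int (Suc n)) + I_BPS t z (- int (Suc n)))"

(* The principal branch of the dilogarithm: the integrand extends continuously to u = 0, and for
   z off the cut {1..} the segment from 0 to z avoids the branch cut of Ln (1 - u). *)
definition dilog :: "complex \<Rightarrow> complex" where
  "dilog z = - contour_integral (linepath 0 z) (\<lambda>u. Ln (1 - u) / u)"

(* The principal logarithm, with an arbitrary choice of branch at each point of the cut. *)
definition log_branch :: "(complex \<Rightarrow> complex) \<Rightarrow> bool" where
  "log_branch L \<longleftrightarrow>
     (\<forall>z. z \<notin> \<real>\<^sub>\<le>\<^sub>0 \<longrightarrow> L z = Ln z) \<and>
     (\<forall>z. z \<noteq> 0 \<longrightarrow> exp (L z) = z)"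

(* The principal dilogarithm, with an arbitrary choice of branch at each point of the cut: the
   monodromy around 1 and then 0 adds integer multiples of 2 pi i log z and of (2 pi i)^2. *)
definition dilog_branch :: "(complex \<Rightarrow> complex) \<Rightarrow> bool" where
  "dilog_branch D \<longleftrightarrow>
     (\<forall>z. z \<notin> complex_of_real ` {1<..} \<longrightarrow> D z = dilog z) \<and>
     (\<forall>x>1. \<exists>k m::int. D (complex_of_real x) =
        dilog (complex_of_real x) + of_int k * (2 * of_real pi * \<i>) * of_real (ln x)
          + of_int m * (2 * of_real pi * \<i>)\<^sup>2)"

definition Z_dual ::
  "(complex \<Rightarrow> complex) \<Rightarrow> (complex \<Rightarrow> complex) \<Rightarrow> complex \<Rightarrow> complex" where
  "Z_dual L D t =
     (let q = exp (2 * of_real pi * \<i> * t)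
      in - (1 / (2 * of_real pi * \<i>)\<^sup>2) * (1 / 2 * (L q)\<^sup>2 + D q))"

definition X_dual ::
  "(complex \<Rightarrow> complex) \<Rightarrow> (complex \<Rightarrow> complex) \<Rightarrow> complex \<Rightarrow> complex \<Rightarrow> complex" where
  "X_dual L D t z =
     exp (2 * of_real pi * \<i> * Z_dual L D t / z) * exp (log_X_inst t z)"

end

theory Submission
  imports Defs
begin

text \<open>
  Parametrising the ray shows that \<open>I_BPS t z n = G (\<i> * z / (t + of_int n))\<close>, where
  \<open>G \<zeta> = - 1 / (pi * \<i>) * (\<integral> f s * \<zeta> / (s\<^sup>2 - \<zeta>\<^sup>2) ds)\<close> over \<open>s > 0\<close> with
  \<open>f s = ln (1 - exp (- 2 * pi / s))\<close>. In the code \<open>f\<close> is \<open>ray_log\<close> and \<open>G\<close> is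
  \<open>ray_transform\<close>; \<open>G\<close> is odd. The theorem follows from a bound of the form
  \<open>a + b * ln (norm z)\<close> for \<open>log_X_inst\<close> on \<open>S\<close>, since the exponent with the central charge
  \<open>Z_dual\<close> tends to \<open>0\<close> as \<open>z\<close> tends to infinity.

  Everything rests on \<open>- 1 / s \<le> f' s \<le> 0\<close>, hence \<open>\<bar>f s - f R\<bar> \<le> \<bar>ln (s / R)\<bar>\<close>,
  and on the fact that the kernel \<open>\<zeta> / (s\<^sup>2 - \<zeta>\<^sup>2)\<close> has the integral \<open>\<plusminus>\<i> * pi / 2\<close>,
  with the sign of \<open>Im \<zeta>\<close>. Subtracting the constant \<open>f R\<close> from \<open>f\<close> with \<open>R = norm \<zeta>\<close>
  cancels the near-singularity of the kernel at \<open>s = R\<close> and gives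
  \<open>norm (G \<zeta>) \<le> \<bar>f (norm \<zeta>)\<bar> + 1\<close> for every nonreal \<open>\<zeta>\<close>
  (\<open>norm_ray_transform_le\<close>). So each single integral is \<open>O(ln (norm z))\<close>, uniformly up to
  the boundary of \<open>S\<close>, even where the boundary is a BPS ray.

  Adding up these bounds is not enough: about \<open>norm z\<close> terms are of order one or larger. The pairs
  \<open>n\<close> and \<open>- n\<close> have to cancel. A sector without BPS rays has bounded slopes
  (\<open>sector_slope_bounded\<close>), because the BPS rays accumulate at the imaginary axis from both sides.
  So for \<open>n\<close> above a bound that depends on \<open>S\<close> and \<open>t\<close> only, \<open>\<zeta> = \<i> * z / (n + t)\<close> and
  \<open>\<xi> = \<i> * z / (n - t)\<close> lie in one half plane and well away from the real axis. There
  \<open>G \<zeta> - G \<xi>\<close> is of the order of the minimum of \<open>1 / n\<close> and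
  \<open>norm z / n\<^sup>2\<close> (\<open>ray_transform_diff_le\<close>, \<open>BPS_pair_bound\<close>), where the first bound again
  subtracts a constant from \<open>f\<close>. The sum of such terms is of order \<open>ln (1 + norm z)\<close>, by
  comparison with a telescoping series (\<open>le_logarithmic_telescope\<close>).
\<close>

section \<open>The logarithm on a BPS ray\<close>

text \<open>
  The logarithm in the integrand of \<open>I_BPS\<close>, on the ray parametrised by
  \<open>s \<mapsto> - \<i> * (t + of_int n) * s\<close>; the parametrisation removes \<open>t\<close> and \<open>n\<close> from it.
\<close>
definition ray_log :: "real \<Rightarrow> real" where
  "ray_log s = ln (1 - exp (- 2 * pi / s))"

lemma exp_ray_less_1: "s > 0 \<Longrightarrow> exp (- 2 * pi / s) < 1"
  by (simp add: divide_neg_pos)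

lemma ray_log_has_derivative:
  assumes "s > 0"
  shows "(ray_log has_real_derivative
     - (2 * pi / s\<^sup>2) * exp (- 2 * pi / s) / (1 - exp (- 2 * pi / s))) (at s)"
  unfolding ray_log_def using exp_ray_less_1[OF assms] assms
  by (auto intro!: derivative_eq_intros simp: power2_eq_square field_simps)

text \<open>
  With \<open>u = 2 * pi / s\<close> the derivative is \<open>- (u / (exp u - 1)) / s\<close>, and the fraction in
  parentheses lies between \<open>0\<close> and \<open>1\<close> because \<open>1 + u \<le> exp u\<close>.
\<close>
lemma ray_log_derivative_bounds:
  assumes "s > 0"
  shows "- 1 / s \<le> - (2 * pi / s\<^sup>2) * exp (- 2 * pi / s) / (1 - exp (- 2 * pi / s))"
    and "- (2 * pi / s\<^sup>2) * exp (- 2 * pi / s) / (1 - exp (- 2 * pi / s)) \<le> 0"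
proof -
  define u where "u = 2 * pi / s"
  have u: "u > 0" using assms by (simp add: u_def)
  have e: "exp (-u) < 1" using u by simp
  have "exp (-u) * (1 + u) \<le> exp (-u) * exp u"
    by (intro mult_left_mono) auto
  also have "\<dots> = 1" by (simp add: exp_minus)
  finally have "u * exp (-u) / (1 - exp (-u)) \<le> 1"
    using e by (simp add: field_simps)
  hence "u * exp (-u) / (1 - exp (-u)) / s \<le> 1 / s"
    using assms by (intro divide_right_mono) auto
  moreover have "- (2 * pi / s\<^sup>2) * exp (- 2 * pi / s) / (1 - exp (- 2 * pi / s))
     = - (u * exp (-u) / (1 - exp (-u)) / s)"
    using assms by (simp add: u_def power2_eq_square)
  moreover have "u * exp (-u) / (1 - exp (-u)) / s \<ge> 0"
    using u e assms by (intro divide_nonneg_nonneg mult_nonneg_nonneg) auto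
  ultimately show "- 1 / s \<le> - (2 * pi / s\<^sup>2) * exp (- 2 * pi / s) / (1 - exp (- 2 * pi / s))"
    and "- (2 * pi / s\<^sup>2) * exp (- 2 * pi / s) / (1 - exp (- 2 * pi / s)) \<le> 0" by auto
qed

text \<open>
  Up to constants, \<open>ray_log\<close> decreases no faster than \<open>- ln\<close>. This is the only regularity of the
  logarithm that the estimates near the singularity of the kernel need, and it is invariant under
  scaling \<open>s\<close>, which is why all later bounds are uniform in the scale \<open>R\<close>.
\<close>
lemma ray_log_mono:
  assumes "0 < r" "r \<le> s"
  shows "ray_log s \<le> ray_log r" and "ray_log r + ln r \<le> ray_log s + ln s"
proof -
  show "ray_log s \<le> ray_log r"
    using assms ray_log_has_derivative ray_log_derivative_bounds(2)
    by (intro DERIV_nonpos_imp_nonincreasing[of r s ray_log]) (metis less_le_trans)+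
  have "\<exists>y. ((\<lambda>x. ray_log x + ln x) has_real_derivative y) (at x) \<and> 0 \<le> y"
    if "r \<le> x" for x
  proof -
    have x: "x > 0" using that assms by simp
    have "((\<lambda>x. ray_log x + ln x) has_real_derivative
        - (2 * pi / x\<^sup>2) * exp (- 2 * pi / x) / (1 - exp (- 2 * pi / x)) + 1 / x) (at x)"
      using x by (intro DERIV_add ray_log_has_derivative DERIV_ln_divide)
    moreover have "0 \<le> - (2 * pi / x\<^sup>2) * exp (- 2 * pi / x) / (1 - exp (- 2 * pi / x)) + 1 / x"
      using ray_log_derivative_bounds(1)[OF x] by simp
    ultimately show ?thesis by blast
  qed
  thus "ray_log r + ln r \<le> ray_log s + ln s"
    using assms by (intro DERIV_nonneg_imp_nondecreasing[of r s "\<lambda>x. ray_log x + ln x"]) auto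
qed

lemma ray_log_diff_le:
  assumes "r > 0" "s > 0"
  shows "\<bar>ray_log s - ray_log r\<bar> \<le> \<bar>ln s - ln r\<bar>"
proof (cases "r \<le> s")
  case True
  then show ?thesis using ray_log_mono[of r s] assms by auto
next
  case False
  then show ?thesis using ray_log_mono[of s r] assms by auto
qed

text \<open>
  In terms of \<open>u = ln x / 2\<close> this is \<open>u \<le> sinh u\<close>. It turns logarithms into an algebraic
  expression with an elementary integral.
\<close>
lemma ln_le_sqrt_form:
  fixes x :: real
  assumes "x \<ge> 1"
  shows "ln x \<le> (x - 1) / sqrt x"
proof -
  define f where "f = (\<lambda>x::real. sqrt x - 1 / sqrt x - ln x)"
  have "f 1 \<le> f x"
  proof (rule DERIV_nonneg_imp_nondecreasing[OF assms])
    fix y :: real assume y: "1 \<le> y"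
    define q where "q = sqrt y"
    have q: "q > 0" "y = q\<^sup>2" using y by (auto simp: q_def)
    have "(f has_real_derivative (inverse q / 2 + (inverse q / 2) / q\<^sup>2 - 1 / y)) (at y)"
      unfolding f_def q_def using y
      by (auto intro!: derivative_eq_intros simp: field_simps power2_eq_square)
    moreover have "inverse q / 2 + (inverse q / 2) / q\<^sup>2 - 1 / y = (q - 1)\<^sup>2 / (2 * q ^ 3)"
      unfolding q(2) using q(1)
      by (simp add: field_simps power2_eq_square power3_eq_cube)
    moreover have "\<dots> \<ge> 0" using q(1) by simp
    ultimately show "\<exists>z. (f has_real_derivative z) (at y) \<and> 0 \<le> z" by metis
  qed
  moreover have "(x - 1) / sqrt x = sqrt x - 1 / sqrt x"
    using assms by (simp add: field_simps)
  ultimately show ?thesis by (simp add: f_def)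
qed

lemma abs_ln_diff_le:
  assumes "r > 0" "s > 0"
  shows "\<bar>ln s - ln r\<bar> \<le> \<bar>s - r\<bar> / sqrt (s * r)"
proof -
  have *: "\<bar>ln s - ln r\<bar> \<le> \<bar>s - r\<bar> / sqrt (s * r)" if "0 < r" "r \<le> s" for r s :: real
  proof -
    have sq: "r * sqrt (s / r) = sqrt (s * r)"
      using that by (simp add: real_sqrt_divide real_sqrt_mult real_div_sqrt field_simps)
    have "ln s - ln r = ln (s / r)" using that by (simp add: ln_div)
    also have "\<dots> \<le> (s / r - 1) / sqrt (s / r)"
      using that by (intro ln_le_sqrt_form) auto
    also have "\<dots> = (s - r) / (r * sqrt (s / r))" using that by (simp add: field_simps)
    finally show ?thesis using that unfolding sq by simp
  qed
  show ?thesis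
    using *[of r s] *[of s r] assms
    by (cases "r \<le> s") (auto simp: abs_minus_commute mult.commute)
qed

lemma abs_ray_log_le:
  assumes "s > 0"
  shows "\<bar>ray_log s\<bar> \<le> \<bar>ray_log 1\<bar> + \<bar>ln s\<bar>"
  using ray_log_diff_le[of 1 s] assms by simp

text \<open>
  A crude substitute for the exponential decay of \<open>ray_log\<close> at \<open>0\<close>, just strong enough to make
  \<open>ray_log s / s\<^sup>2\<close> bounded there.
\<close>
lemma abs_ray_log_le_square:
  assumes "s > 0"
  shows "\<bar>ray_log s\<bar> \<le> s\<^sup>2"
proof -
  define u where "u = 2 * pi / s"
  have u: "u > 0" using assms by (simp add: u_def)
  have e: "exp (-u) < 1" using u by simp
  have "- ray_log s = ln (1 / (1 - exp (-u)))"
    using e by (simp add: ray_log_def u_def ln_div)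
  also have "\<dots> \<le> 1 / (1 - exp (-u)) - 1"
    using e by (intro ln_le_minus_one) simp
  also have "\<dots> = 1 / (exp u - 1)"
    using e u by (simp add: exp_minus field_simps)
  also have "\<dots> \<le> 1 / (u\<^sup>2 / 2)"
    using exp_lower_Taylor_quadratic[of u] u by (intro divide_left_mono) auto
  also have "\<dots> = s\<^sup>2 * (2 / (2 * pi)\<^sup>2)"
    using assms by (simp add: u_def power_divide field_simps)
  also have "\<dots> \<le> s\<^sup>2 * 1"
  proof (intro mult_left_mono)
    have "(2::real) \<le> 2 * 2" by simp
    also have "\<dots> \<le> (2 * pi) * (2 * pi)" using pi_ge_two by (intro mult_mono) auto
    finally show "2 / (2 * pi)\<^sup>2 \<le> 1" by (simp add: power2_eq_square)
  qed simp
  finally have "- ray_log s \<le> s\<^sup>2" by simp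
  moreover have "ray_log s \<le> 0"
    using e by (simp add: ray_log_def u_def)
  ultimately show ?thesis by simp
qed

lemma measurable_ray_log [measurable]: "ray_log \<in> borel_measurable borel"
  unfolding ray_log_def by measurable

section \<open>An integrable majorant\<close>

text \<open>
  The one integrable function that dominates everything below. It has size \<open>1 / R\<^sup>2\<close> at
  \<open>s = R\<close>, an integrable singularity at \<open>0\<close>, and decays like \<open>s powr (- 3 / 2)\<close>, which
  leaves room for a logarithm over \<open>s\<^sup>2\<close>.
\<close>
definition majorant :: "real \<Rightarrow> real \<Rightarrow> real" where
  "majorant R s = 1 / ((s + R) * sqrt (s * R))"

lemma majorant_nonneg: "R > 0 \<Longrightarrow> s > 0 \<Longrightarrow> majorant R s \<ge> 0"
  by (simp add: majorant_def)

lemma inverse_sum_squares_le_majorant: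
  assumes "R > 0" "s > 0"
  shows "1 / (s\<^sup>2 + R\<^sup>2) \<le> majorant R s"
proof -
  have "(s + R) * sqrt (s * R) \<le> (s + R) * ((s + R) / 2)"
    using assms by (intro mult_left_mono arith_geo_mean_sqrt) auto
  also have "\<dots> \<le> s\<^sup>2 + R\<^sup>2"
    using zero_le_power2[of "s - R"] by (simp add: power2_eq_square algebra_simps)
  finally show ?thesis
    unfolding majorant_def using assms
    by (intro divide_left_mono) (auto intro!: mult_pos_pos add_pos_pos)
qed

lemma majorant_integral:
  assumes R: "R > 0"
  shows "set_integrable lborel {0<..} (majorant R)"
    and "(LINT s:{0<..}|lborel. majorant R s) = pi / R"
proof -
  define F where "F = (\<lambda>s. 2 / R * arctan (sqrt (s / R)))"
  have D: "DERIV F s :> majorant R s" if "s > 0" for s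
  proof -
    have sq: "sqrt (s * R) = R * sqrt (s / R)"
      using that R by (simp add: real_sqrt_divide real_sqrt_mult real_div_sqrt field_simps)
    have "DERIV (\<lambda>s. s / R) s :> 1 / R"
      by (intro DERIV_cdivide DERIV_ident)
    moreover have "DERIV sqrt (s / R) :> inverse (sqrt (s / R)) / 2"
      using that R by (intro DERIV_real_sqrt) auto
    ultimately have "DERIV (\<lambda>s. sqrt (s / R)) s :> inverse (sqrt (s / R)) / 2 * (1 / R)"
      by (rule DERIV_chain2[rotated])
    from DERIV_cmult[OF DERIV_chain2[OF DERIV_arctan this], of "2 / R"]
    have "DERIV F s :> 2 / R * (inverse (1 + (sqrt (s / R))\<^sup>2) * (inverse (sqrt (s / R)) / 2 * (1 / R)))"
      unfolding F_def .
    also have "2 / R * (inverse (1 + (sqrt (s / R))\<^sup>2) * (inverse (sqrt (s / R)) / 2 * (1 / R))) = majorant R s"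
      unfolding majorant_def sq using that R by (simp add: divide_simps)
    finally show ?thesis .
  qed
  have cont: "isCont (majorant R) s" if "s > 0" for s
    unfolding majorant_def using that R by (intro continuous_intros) auto
  have "continuous (at_right 0) F"
    unfolding F_def using R by (intro continuous_intros) auto
  hence A: "(F \<longlongrightarrow> 0) (at_right 0)"
    by (simp add: continuous_within F_def)
  have "filterlim (\<lambda>s. s * (1 / R)) at_top at_top"
    by (rule filterlim_at_top_mult_tendsto_pos[OF tendsto_const _ filterlim_ident]) (use R in auto)
  hence "filterlim (\<lambda>s. sqrt (s / R)) at_top at_top"
    by (intro filterlim_compose[OF sqrt_at_top]) simp
  hence "((\<lambda>s. arctan (sqrt (s / R))) \<longlongrightarrow> pi / 2) at_top"
    by (intro filterlim_compose[OF tendsto_arctan_at_top])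
  hence "(F \<longlongrightarrow> 2 / R * (pi / 2)) at_top"
    unfolding F_def by (intro tendsto_intros)
  hence B: "(F \<longlongrightarrow> pi / R) at_top" by simp
  have 0: "set_integrable lborel (einterval 0 \<infinity>) (majorant R)"
          "(LBINT x=0..\<infinity>. majorant R x) = pi / R - 0"
    by (rule interval_integral_FTC_nonneg[where F = F and A = 0 and B = "pi / R"];
        use D cont A B R in \<open>auto simp: ereal_tendsto_simps zero_ereal_def majorant_nonneg\<close>)+
  show "set_integrable lborel {0<..} (majorant R)"
    using 0(1) by (simp add: zero_ereal_def)
  show "(LINT s:{0<..}|lborel. majorant R s) = pi / R"
    using 0(2) by (simp add: zero_ereal_def interval_lebesgue_integral_def)
qed

text \<open>
  The zero of the numerator at \<open>s = R\<close> cancels the zero of the denominator, so the quotient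
  stays integrable; by scale invariance its integral is at most \<open>pi / R\<close>.
\<close>
lemma ray_log_quotient_le_majorant:
  assumes "R > 0" "s > 0"
  shows "\<bar>ray_log s - ray_log R\<bar> / \<bar>s\<^sup>2 - R\<^sup>2\<bar> \<le> majorant R s"
proof (cases "s = R")
  case True
  then show ?thesis using assms by (simp add: majorant_def)
next
  case False
  have "\<bar>ray_log s - ray_log R\<bar> / \<bar>s\<^sup>2 - R\<^sup>2\<bar> \<le> (\<bar>s - R\<bar> / sqrt (s * R)) / \<bar>s\<^sup>2 - R\<^sup>2\<bar>"
    using ray_log_diff_le[of R s] abs_ln_diff_le[of R s] assms
    by (intro divide_right_mono) auto
  also have "\<dots> = (\<bar>s - R\<bar> / sqrt (s * R)) / (\<bar>s - R\<bar> * (s + R))"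
    using assms by (simp add: power2_eq_square square_diff_square_factored abs_mult mult.commute)
  also have "\<dots> = majorant R s"
    using False by (simp add: majorant_def)
  finally show ?thesis .
qed

lemma set_integrable_ray_log_over_square:
  "set_integrable lborel {0<..} (\<lambda>s. \<bar>ray_log s\<bar> / s\<^sup>2)"
proof (rule set_integrable_bound)
  define C where "C = 2 * (\<bar>ray_log 1\<bar> + 1)"
  have "\<bar>ray_log s\<bar> / s\<^sup>2 \<le> C * majorant 1 s" if s: "s > 0" for s
  proof (cases "s \<le> 1")
    case True
    have "(s + 1) * sqrt s \<le> 2 * 1"
      using True s by (intro mult_mono) auto
    hence "1 / 2 \<le> majorant 1 s"
      using s unfolding majorant_def by (simp add: divide_simps)
    moreover have "\<bar>ray_log s\<bar> / s\<^sup>2 \<le> 1"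
      using abs_ray_log_le_square[OF s] s by simp
    moreover have "C * (1 / 2) \<le> C * majorant 1 s"
      using calculation(1) by (intro mult_left_mono) (auto simp: C_def)
    moreover have "C * (1 / 2) \<ge> 1" by (simp add: C_def)
    ultimately show ?thesis by linarith
  next
    case False
    define q where "q = sqrt s"
    have q: "q > 1" "s = q\<^sup>2" using False by (auto simp: q_def)
    have "\<bar>ln s\<bar> \<le> (s - 1) / sqrt s"
      using ln_le_sqrt_form[of s] False by simp
    also have "\<dots> \<le> s / sqrt s" using s by (intro divide_right_mono) auto
    also have "\<dots> = q" using s by (simp add: q_def real_div_sqrt)
    finally have "\<bar>ray_log s\<bar> \<le> \<bar>ray_log 1\<bar> * 1 + 1 * q"
      using abs_ray_log_le[OF s] by simp
    also have "\<dots> \<le> \<bar>ray_log 1\<bar> * q + 1 * q"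
      using q by (intro add_mono mult_left_mono) auto
    also have "\<dots> = C / 2 * q" by (simp add: C_def algebra_simps)
    finally have "\<bar>ray_log s\<bar> / s\<^sup>2 \<le> C / 2 * q / s\<^sup>2"
      by (intro divide_right_mono) auto
    also have "\<dots> = C * (1 / ((s + s) * q))"
      using q by (simp add: power2_eq_square field_simps)
    also have "\<dots> \<le> C * (1 / ((s + 1) * q))"
      using q False s by (intro mult_left_mono divide_left_mono mult_right_mono) (auto simp: C_def)
    also have "\<dots> = C * majorant 1 s" by (simp add: majorant_def q_def)
    finally show ?thesis .
  qed
  thus "AE s in lborel. s \<in> {0<..} \<longrightarrow>
      norm (\<bar>ray_log s\<bar> / s\<^sup>2) \<le> norm (C * majorant 1 s)"
    using majorant_nonneg[of 1] by (auto simp: C_def)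
  show "set_integrable lborel {0<..} (\<lambda>s. C * majorant 1 s)"
    using majorant_integral(1)[of 1] by simp
  show "set_borel_measurable lborel {0<..} (\<lambda>s. \<bar>ray_log s\<bar> / s\<^sup>2)"
    unfolding set_borel_measurable_def by measurable
qed

section \<open>The antisymmetrised Cauchy kernel\<close>

text \<open>
  Equal to \<open>(1 / (s - \<zeta>) - 1 / (s + \<zeta>)) / 2\<close>, the Cauchy kernel antisymmetrised in \<open>\<zeta>\<close>.
\<close>
definition cauchy_kernel :: "complex \<Rightarrow> real \<Rightarrow> complex" where
  "cauchy_kernel \<zeta> s = \<zeta> / ((of_real s)\<^sup>2 - \<zeta>\<^sup>2)"

text \<open>
  This bound involves only \<open>norm \<zeta>\<close>, so it survives when \<open>\<zeta>\<close> approaches the real axis, that is,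
  when \<open>z\<close> approaches a boundary ray of the sector.
\<close>
lemma kernel_denominator_ge_radial:
  "\<bar>s\<^sup>2 - (norm \<zeta>)\<^sup>2\<bar> \<le> norm ((of_real s)\<^sup>2 - \<zeta>\<^sup>2 :: complex)"
  using norm_triangle_ineq3[of "(of_real s)\<^sup>2 :: complex" "\<zeta>\<^sup>2"] by (simp add: norm_power)

text \<open>
  If \<open>\<zeta>\<close> stays at a distance comparable with \<open>R\<close> from the real axis, then both \<open>s - \<zeta>\<close>
  and \<open>s + \<zeta>\<close> are comparable with \<open>s + R\<close>.
\<close>
lemma kernel_denominator_ge_sector:
  assumes "\<delta> > 0" "s > 0" "R > 0" "\<delta> * R \<le> \<bar>Im \<zeta>\<bar>" "norm \<zeta> \<le> 2 * R"
  shows "s\<^sup>2 + R\<^sup>2 \<le> (1 + 3 / \<delta>)\<^sup>2 * norm ((of_real s)\<^sup>2 - \<zeta>\<^sup>2)"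
proof -
  have *: "s + R \<le> (1 + 3 / \<delta>) * norm (of_real s - w)"
    if "\<delta> * R \<le> \<bar>Im w\<bar>" "norm w \<le> 2 * R" for w
  proof -
    define d where "d = norm (of_real s - w)"
    have "\<bar>Im w\<bar> \<le> d" using abs_Im_le_cmod[of "of_real s - w"] by (simp add: d_def)
    hence "\<delta> * R \<le> d" using that by linarith
    hence R: "R \<le> d / \<delta>" using assms by (simp add: field_simps)
    have "s \<le> d + norm w"
      using norm_triangle_ineq[of "of_real s - w" w] assms by (simp add: d_def)
    hence "s + R \<le> d + 3 * (d / \<delta>)" using that R by linarith
    thus ?thesis by (simp add: d_def algebra_simps)
  qed
  have "s\<^sup>2 + R\<^sup>2 \<le> (s + R) * (s + R)"
    using assms by (simp add: power2_eq_square algebra_simps)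
  also have "\<dots> \<le> ((1 + 3 / \<delta>) * norm (of_real s - \<zeta>)) * ((1 + 3 / \<delta>) * norm (of_real s - (- \<zeta>)))"
    using assms by (intro mult_mono *) auto
  also have "\<dots> = (1 + 3 / \<delta>)\<^sup>2 * norm ((of_real s - \<zeta>) * (of_real s - (- \<zeta>)))"
    by (simp add: power2_eq_square norm_mult)
  also have "(of_real s - \<zeta>) * (of_real s - (- \<zeta>)) = (of_real s)\<^sup>2 - \<zeta>\<^sup>2"
    by (simp add: power2_eq_square algebra_simps)
  finally show ?thesis .
qed

lemma kernel_denominator_nonzero:
  assumes "Im \<zeta> \<noteq> 0"
  shows "(of_real s)\<^sup>2 - \<zeta>\<^sup>2 \<noteq> 0"
proof
  assume "(of_real s)\<^sup>2 - \<zeta>\<^sup>2 = 0"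
  hence "of_real s = \<zeta> \<or> of_real s = - \<zeta>" by (simp add: power2_eq_iff)
  thus False using assms by (metis Im_complex_of_real add.inverse_neutral neg_equal_iff_equal uminus_complex.sel(2))
qed

lemma measurable_cauchy_kernel [measurable]: "cauchy_kernel \<zeta> \<in> borel_measurable borel"
  unfolding cauchy_kernel_def by measurable

lemma cauchy_kernel_decay:
  assumes "Im \<zeta> \<noteq> 0"
  obtains C where "C \<ge> 0" "\<And>s. s > 0 \<Longrightarrow> norm (cauchy_kernel \<zeta> s) \<le> C / (s\<^sup>2 + (norm \<zeta>)\<^sup>2)"
proof
  \<comment> \<open>the sector bound, applied to the sector that \<open>\<zeta>\<close> itself spans\<close>
  define \<delta> where "\<delta> = \<bar>Im \<zeta>\<bar> / norm \<zeta>"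
  define C where "C = norm \<zeta> * (1 + 3 / \<delta>)\<^sup>2"
  have z: "norm \<zeta> > 0" using assms by auto
  show "C \<ge> 0" by (simp add: C_def)
  fix s :: real assume s: "s > 0"
  have "s\<^sup>2 + (norm \<zeta>)\<^sup>2 \<le> (1 + 3 / \<delta>)\<^sup>2 * norm ((of_real s)\<^sup>2 - \<zeta>\<^sup>2)"
    using assms s z by (intro kernel_denominator_ge_sector) (auto simp: \<delta>_def)
  moreover have "s\<^sup>2 + (norm \<zeta>)\<^sup>2 > 0" using z by (intro add_nonneg_pos) auto
  moreover have "norm ((of_real s)\<^sup>2 - \<zeta>\<^sup>2) > 0" using kernel_denominator_nonzero[OF assms] by simp
  ultimately have "1 / norm ((of_real s)\<^sup>2 - \<zeta>\<^sup>2) \<le> (1 + 3 / \<delta>)\<^sup>2 / (s\<^sup>2 + (norm \<zeta>)\<^sup>2)"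
    by (simp add: divide_simps mult.commute)
  hence "norm \<zeta> * (1 / norm ((of_real s)\<^sup>2 - \<zeta>\<^sup>2)) \<le> norm \<zeta> * ((1 + 3 / \<delta>)\<^sup>2 / (s\<^sup>2 + (norm \<zeta>)\<^sup>2))"
    by (intro mult_left_mono) auto
  thus "norm (cauchy_kernel \<zeta> s) \<le> C / (s\<^sup>2 + (norm \<zeta>)\<^sup>2)"
    by (simp add: cauchy_kernel_def norm_divide C_def)
qed

lemma set_integrable_cauchy_kernel:
  assumes "Im \<zeta> \<noteq> 0"
  shows "set_integrable lborel {0<..} (cauchy_kernel \<zeta>)"
proof -
  obtain C where C: "C \<ge> 0" "\<And>s. s > 0 \<Longrightarrow> norm (cauchy_kernel \<zeta> s) \<le> C / (s\<^sup>2 + (norm \<zeta>)\<^sup>2)"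
    using cauchy_kernel_decay[OF assms] by blast
  have z: "norm \<zeta> > 0" using assms by auto
  have "norm (cauchy_kernel \<zeta> s) \<le> norm (C * majorant (norm \<zeta>) s)" if s: "s > 0" for s
  proof -
    have "norm (cauchy_kernel \<zeta> s) \<le> C * (1 / (s\<^sup>2 + (norm \<zeta>)\<^sup>2))" using C(2)[OF s] by simp
    also have "\<dots> \<le> C * majorant (norm \<zeta>) s"
      using C(1) s z by (intro mult_left_mono inverse_sum_squares_le_majorant)
    finally show ?thesis by simp
  qed
  hence bound: "AE s in lborel. s \<in> {0<..} \<longrightarrow>
      norm (cauchy_kernel \<zeta> s) \<le> norm (C * majorant (norm \<zeta>) s)"
    by (intro AE_I2 impI) (simp only: greaterThan_iff)
  show ?thesis
  proof (rule set_integrable_bound[OF _ _ bound])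
    show "set_integrable lborel {0<..} (\<lambda>s. C * majorant (norm \<zeta>) s)"
      using majorant_integral(1)[OF z] by (rule set_integrable_mult_right)
    show "set_borel_measurable lborel {0<..} (cauchy_kernel \<zeta>)"
      unfolding set_borel_measurable_def by measurable
  qed
qed

lemma set_integrable_ray_log_cauchy_kernel:
  assumes "Im \<zeta> \<noteq> 0"
  shows "set_integrable lborel {0<..} (\<lambda>s. of_real (ray_log s) * cauchy_kernel \<zeta> s)"
proof -
  obtain C where C: "C \<ge> 0" "\<And>s. s > 0 \<Longrightarrow> norm (cauchy_kernel \<zeta> s) \<le> C / (s\<^sup>2 + (norm \<zeta>)\<^sup>2)"
    using cauchy_kernel_decay[OF assms] by blast
  have "norm (of_real (ray_log s) * cauchy_kernel \<zeta> s) \<le> norm (C * (\<bar>ray_log s\<bar> / s\<^sup>2))"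
    if s: "s > 0" for s
  proof -
    have "norm (of_real (ray_log s) * cauchy_kernel \<zeta> s) \<le> \<bar>ray_log s\<bar> * (C / (s\<^sup>2 + (norm \<zeta>)\<^sup>2))"
      unfolding norm_mult norm_of_real using C(2)[OF s] by (intro mult_left_mono) auto
    also have "\<dots> \<le> \<bar>ray_log s\<bar> * (C / s\<^sup>2)"
      using s C(1) by (intro mult_left_mono divide_left_mono) (auto intro!: mult_pos_pos add_pos_nonneg)
    finally show ?thesis using C(1) by (simp add: mult.commute abs_mult)
  qed
  hence bound: "AE s in lborel. s \<in> {0<..} \<longrightarrow>
      norm (of_real (ray_log s) * cauchy_kernel \<zeta> s) \<le> norm (C * (\<bar>ray_log s\<bar> / s\<^sup>2))"
    by (intro AE_I2 impI) (simp only: greaterThan_iff)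
  show ?thesis
  proof (rule set_integrable_bound[OF _ _ bound])
    show "set_integrable lborel {0<..} (\<lambda>s. C * (\<bar>ray_log s\<bar> / s\<^sup>2))"
      using set_integrable_ray_log_over_square by (rule set_integrable_mult_right)
    show "set_borel_measurable lborel {0<..} (\<lambda>s. of_real (ray_log s) * cauchy_kernel \<zeta> s)"
      unfolding set_borel_measurable_def by measurable
  qed
qed

text \<open>
  The primitive \<open>(Ln (s - \<zeta>) - Ln (s + \<zeta>)) / 2\<close> tends to \<open>0\<close> at infinity. The integral
  depends only on the half plane that contains \<open>\<zeta>\<close>, so subtracting a constant from \<open>ray_log\<close> costs
  at most a multiple of that constant, and nothing at all in a difference of two kernels in the same half plane.
\<close>
lemma integral_cauchy_kernel:
  assumes "Im \<zeta> \<noteq> 0"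
  shows "(LINT s:{0<..}|lborel. cauchy_kernel \<zeta> s) = of_real (sgn (Im \<zeta>)) * (\<i> * of_real pi / 2)"
proof -
  define F where "F = (\<lambda>s::real. (Ln (of_real s - \<zeta>) - Ln (of_real s + \<zeta>)) / 2)"
  have nr: "of_real s - \<zeta> \<notin> \<real>\<^sub>\<le>\<^sub>0" "of_real s + \<zeta> \<notin> \<real>\<^sub>\<le>\<^sub>0" for s
    using assms by (auto simp: complex_nonpos_Reals_iff)
  have ne: "of_real s - \<zeta> \<noteq> 0" "of_real s + \<zeta> \<noteq> 0" for s
    using nr[of s] by auto
  have deriv: "(F has_vector_derivative cauchy_kernel \<zeta> s) (at s)" for s
  proof -
    have "((\<lambda>x. Ln (x - \<zeta>)) has_field_derivative inverse (of_real s - \<zeta>) * (1 - 0)) (at (of_real s))"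
      by (rule DERIV_chain2[where f = Ln and g = "\<lambda>x. x - \<zeta>"])
         (intro has_field_derivative_Ln nr DERIV_diff DERIV_ident DERIV_const)+
    moreover have "((\<lambda>x. Ln (x + \<zeta>)) has_field_derivative inverse (of_real s + \<zeta>) * (1 + 0)) (at (of_real s))"
      by (rule DERIV_chain2[where f = Ln and g = "\<lambda>x. x + \<zeta>"])
         (intro has_field_derivative_Ln nr DERIV_add DERIV_ident DERIV_const)+
    ultimately have "((\<lambda>x. (Ln (x - \<zeta>) - Ln (x + \<zeta>)) / 2) has_field_derivative
        (inverse (of_real s - \<zeta>) * (1 - 0) - inverse (of_real s + \<zeta>) * (1 + 0)) / 2) (at (of_real s))"
      by (intro DERIV_cdivide DERIV_diff)
    also have "(inverse (of_real s - \<zeta>) * (1 - 0) - inverse (of_real s + \<zeta>) * (1 + 0)) / 2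
        = \<zeta> / ((of_real s - \<zeta>) * (of_real s + \<zeta>))"
      using ne[of s] by (simp add: divide_simps)
    also have "\<dots> = cauchy_kernel \<zeta> s"
      unfolding cauchy_kernel_def power2_eq_square square_diff_square_factored
      by (simp only: mult.commute)
    finally show ?thesis
      unfolding F_def by (rule has_vector_derivative_real_field)
  qed
  have cont: "isCont (cauchy_kernel \<zeta>) s" for s
    unfolding cauchy_kernel_def
    using kernel_denominator_nonzero[OF assms] by (intro continuous_intros) auto
  have "isCont F 0"
    using deriv has_vector_derivative_continuous by blast
  hence A: "(F \<longlongrightarrow> F 0) (at_right 0)"
    by (simp add: isCont_def filterlim_at_split)
  have "((\<lambda>s. \<zeta> / of_real s) \<longlongrightarrow> 0) at_top"
    by (rule tendsto_divide_0[OF tendsto_const filterlim_of_real_at_infinity])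
  hence "((\<lambda>s. (Ln (1 - \<zeta> / of_real s) - Ln (1 + \<zeta> / of_real s)) / 2) \<longlongrightarrow> (Ln (1 - 0) - Ln (1 + 0)) / 2) at_top"
    by (intro tendsto_intros) auto
  moreover have "\<forall>\<^sub>F s in at_top. (Ln (1 - \<zeta> / of_real s) - Ln (1 + \<zeta> / of_real s)) / 2 = F s"
    using eventually_gt_at_top[of 0]
  proof eventually_elim
    case (elim s)
    have a: "of_real s * (1 - \<zeta> / of_real s) = of_real s - \<zeta>"
         "of_real s * (1 + \<zeta> / of_real s) = of_real s + \<zeta>"
      using elim by (auto simp: field_simps)
    hence "1 - \<zeta> / of_real s \<noteq> 0" "1 + \<zeta> / of_real s \<noteq> 0"
      using ne[of s] by (metis mult_zero_right)+
    hence "Ln (of_real s - \<zeta>) = of_real (ln s) + Ln (1 - \<zeta> / of_real s)"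
          "Ln (of_real s + \<zeta>) = of_real (ln s) + Ln (1 + \<zeta> / of_real s)"
      unfolding a[symmetric] using elim by (simp_all add: Ln_times_of_real Ln_of_real)
    thus ?case by (simp add: F_def)
  qed
  ultimately have B: "(F \<longlongrightarrow> 0) at_top"
    by (simp add: filterlim_cong)
  have "(LBINT s=0..\<infinity>. cauchy_kernel \<zeta> s) = 0 - F 0"
  proof (rule interval_integral_FTC_integrable[where F = F])
    show "set_integrable lborel (einterval 0 \<infinity>) (cauchy_kernel \<zeta>)"
      using set_integrable_cauchy_kernel[OF assms] by (simp add: zero_ereal_def)
    show "((F \<circ> real_of_ereal) \<longlongrightarrow> F 0) (at_right 0)"
      unfolding zero_ereal_def ereal_tendsto_simps by (fact A)
    show "((F \<circ> real_of_ereal) \<longlongrightarrow> 0) (at_left \<infinity>)"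
      unfolding ereal_tendsto_simps by (fact B)
  qed (use deriv cont in simp_all)
  moreover have "Ln (- \<zeta>) = Ln \<zeta> - of_real (sgn (Im \<zeta>)) * (\<i> * of_real pi)"
  proof -
    have "\<zeta> \<noteq> 0" using assms by auto
    thus ?thesis using assms by (auto simp: Ln_minus sgn_if)
  qed
  hence "0 - F 0 = of_real (sgn (Im \<zeta>)) * (\<i> * of_real pi / 2)"
    by (simp add: F_def)
  ultimately show ?thesis by (simp add: zero_ereal_def interval_lebesgue_integral_def)
qed

section \<open>The transform of the logarithm\<close>

lemma norm_set_integral_le:
  fixes g :: "real \<Rightarrow> complex"
  assumes "set_integrable M A g" "set_integrable M A h" "\<And>x. x \<in> A \<Longrightarrow> norm (g x) \<le> h x"
  shows "norm (LINT x:A|M. g x) \<le> (LINT x:A|M. h x)"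
  using assms unfolding set_integrable_def set_lebesgue_integral_def
  by (intro Bochner_Integration.integral_norm_bound_integral) (auto simp: indicator_def)

text \<open>
  All the integrals \<open>I_BPS t z n\<close> are values of this one function of a single variable.
\<close>
definition ray_transform :: "complex \<Rightarrow> complex" where
  "ray_transform \<zeta> =
     - (1 / (of_real pi * \<i>)) * (LINT s:{0<..}|lborel. of_real (ray_log s) * cauchy_kernel \<zeta> s)"

lemma ray_transform_minus: "ray_transform (- \<zeta>) = - ray_transform \<zeta>"
proof -
  have "of_real (ray_log s) * cauchy_kernel (- \<zeta>) s
      = - 1 * (of_real (ray_log s) * cauchy_kernel \<zeta> s)" for s
    by (simp add: cauchy_kernel_def)
  thus ?thesis
    unfolding ray_transform_def by (simp only: set_integral_mult_right) simp
qed

text \<open>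
  Subtract from \<open>ray_log\<close> its value at \<open>R = norm \<zeta>\<close>. The constant contributes at most
  \<open>\<bar>ray_log R\<bar> / 2\<close>, and the remainder vanishes where the kernel is large, so that the radial
  bound for the denominator suffices. Hence there is no loss as \<open>\<zeta>\<close> approaches the real axis.
\<close>
lemma norm_ray_transform_le:
  assumes "Im \<zeta> \<noteq> 0"
  shows "norm (ray_transform \<zeta>) \<le> \<bar>ray_log (norm \<zeta>)\<bar> + 1"
proof -
  define R where "R = norm \<zeta>"
  have R: "R > 0" using assms by (auto simp: R_def)
  define K where "K = cauchy_kernel \<zeta>"
  define g where "g = (\<lambda>s. of_real (ray_log s) * K s - of_real (ray_log R) * K s)"
  have iK: "set_integrable lborel {0<..} K"
    unfolding K_def using assms by (rule set_integrable_cauchy_kernel)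
  have ifK: "set_integrable lborel {0<..} (\<lambda>s. of_real (ray_log s) * K s)"
    unfolding K_def using assms by (rule set_integrable_ray_log_cauchy_kernel)
  have icK: "set_integrable lborel {0<..} (\<lambda>s. of_real (ray_log R) * K s)"
    using iK by (rule set_integrable_mult_right)
  have ig: "set_integrable lborel {0<..} g"
    unfolding g_def using ifK icK by (rule set_integral_diff)
  have g_le: "norm (g s) \<le> R * majorant R s" if s: "s \<in> {0<..}" for s
  proof (cases "s = R")
    case True
    then show ?thesis using R by (simp add: g_def majorant_def)
  next
    case False
    have pos: "\<bar>s\<^sup>2 - R\<^sup>2\<bar> > 0" using False s R by (simp add: power2_eq_iff)
    have le: "\<bar>s\<^sup>2 - R\<^sup>2\<bar> \<le> norm ((of_real s)\<^sup>2 - \<zeta>\<^sup>2)"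
      unfolding R_def by (rule kernel_denominator_ge_radial)
    have "norm (g s) = \<bar>ray_log s - ray_log R\<bar> * (R / norm ((of_real s)\<^sup>2 - \<zeta>\<^sup>2))"
      unfolding g_def left_diff_distrib[symmetric] of_real_diff[symmetric] norm_mult norm_of_real
      by (simp add: K_def cauchy_kernel_def norm_divide R_def)
    also have "\<dots> \<le> \<bar>ray_log s - ray_log R\<bar> * (R / \<bar>s\<^sup>2 - R\<^sup>2\<bar>)"
      using pos le R by (intro mult_left_mono divide_left_mono mult_pos_pos) auto
    also have "\<dots> = R * (\<bar>ray_log s - ray_log R\<bar> / \<bar>s\<^sup>2 - R\<^sup>2\<bar>)" by simp
    also have "\<dots> \<le> R * majorant R s"
      using s R by (intro mult_left_mono ray_log_quotient_le_majorant) auto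
    finally show ?thesis .
  qed
  have "norm (LINT s:{0<..}|lborel. g s) \<le> (LINT s:{0<..}|lborel. R * majorant R s)"
    using majorant_integral(1)[OF R] g_le ig
    by (intro norm_set_integral_le set_integrable_mult_right)
  also have "\<dots> = pi"
    using R by (simp add: majorant_integral)
  finally have g_int: "norm (LINT s:{0<..}|lborel. g s) \<le> pi" .
  have "(LINT s:{0<..}|lborel. g s)
      = (LINT s:{0<..}|lborel. of_real (ray_log s) * K s)
        - of_real (ray_log R) * (LINT s:{0<..}|lborel. K s)"
    unfolding g_def set_integral_diff(2)[OF ifK icK] by simp
  hence "(LINT s:{0<..}|lborel. of_real (ray_log s) * K s)
      = (LINT s:{0<..}|lborel. g s) + of_real (ray_log R) * (LINT s:{0<..}|lborel. K s)"
    by simp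
  also have "norm \<dots> \<le> norm (LINT s:{0<..}|lborel. g s)
      + norm (of_real (ray_log R) * (LINT s:{0<..}|lborel. K s))"
    by (rule norm_triangle_ineq)
  also have "norm (of_real (ray_log R) * (LINT s:{0<..}|lborel. K s)) = \<bar>ray_log R\<bar> * (pi / 2)"
    using assms by (simp add: K_def integral_cauchy_kernel norm_mult norm_divide sgn_if)
  also have "\<bar>ray_log R\<bar> * (pi / 2) \<le> \<bar>ray_log R\<bar> * pi"
    by (intro mult_left_mono) auto
  finally have "norm (LINT s:{0<..}|lborel. of_real (ray_log s) * K s) \<le> pi + \<bar>ray_log R\<bar> * pi"
    using g_int by simp
  hence "norm (LINT s:{0<..}|lborel. of_real (ray_log s) * K s) / pi \<le> \<bar>ray_log R\<bar> + 1"
    by (simp add: field_simps)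
  thus ?thesis
    by (simp add: ray_transform_def K_def R_def norm_mult norm_divide)
qed

text \<open>
  The difference of the kernels is
  \<open>(\<zeta> - \<xi>) * (s\<^sup>2 + \<zeta> * \<xi>) / ((s\<^sup>2 - \<zeta>\<^sup>2) * (s\<^sup>2 - \<xi>\<^sup>2))\<close>, and
  in the sector every quadratic factor in it is comparable with \<open>s\<^sup>2 + R\<^sup>2\<close>.
\<close>
lemma cauchy_kernel_diff_le:
  assumes "\<delta> > 0" "s > 0" "R > 0"
    and "\<delta> * R \<le> \<bar>Im \<zeta>\<bar>" "norm \<zeta> \<le> 2 * R"
    and "\<delta> * R \<le> \<bar>Im \<xi>\<bar>" "norm \<xi> \<le> 2 * R"
  shows "norm (cauchy_kernel \<zeta> s - cauchy_kernel \<xi> s)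
      \<le> 4 * (1 + 3 / \<delta>) ^ 4 * norm (\<zeta> - \<xi>) / (s\<^sup>2 + R\<^sup>2)"
proof -
  define Q where "Q = s\<^sup>2 + R\<^sup>2"
  define c where "c = (1 + 3 / \<delta>)\<^sup>2"
  have Q: "Q > 0" using assms by (auto simp: Q_def intro!: add_pos_pos)
  have "\<delta> * R > 0" using assms by simp
  hence "\<bar>Im \<zeta>\<bar> > 0" "\<bar>Im \<xi>\<bar> > 0" using assms by linarith+
  hence Im: "Im \<zeta> \<noteq> 0" "Im \<xi> \<noteq> 0" by simp_all
  define A B where "A = (of_real s)\<^sup>2 - \<zeta>\<^sup>2" and "B = (of_real s)\<^sup>2 - \<xi>\<^sup>2"
  have AB: "A \<noteq> 0" "B \<noteq> 0"
    unfolding A_def B_def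
    using kernel_denominator_nonzero[OF Im(1)] kernel_denominator_nonzero[OF Im(2)] by blast+
  have le: "Q \<le> c * norm A" "Q \<le> c * norm B"
    unfolding Q_def c_def A_def B_def using assms by (intro kernel_denominator_ge_sector; simp)+
  have "Q * Q \<le> (c * norm A) * (c * norm B)"
    using le Q by (intro mult_mono) auto
  hence inv: "1 / (norm A * norm B) \<le> c\<^sup>2 / Q\<^sup>2"
    using AB Q by (simp add: field_simps power2_eq_square)
  have "norm \<zeta> * norm \<xi> \<le> (2 * R) * (2 * R)"
    using assms by (intro mult_mono) auto
  hence "norm \<zeta> * norm \<xi> \<le> 4 * R\<^sup>2" by (simp add: power2_eq_square)
  hence "s\<^sup>2 + norm \<zeta> * norm \<xi> \<le> 4 * s\<^sup>2 + 4 * R\<^sup>2"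
    by (intro add_mono) auto
  hence "s\<^sup>2 + norm \<zeta> * norm \<xi> \<le> 4 * Q" by (simp add: Q_def)
  hence num: "norm ((of_real s)\<^sup>2 + \<zeta> * \<xi>) \<le> 4 * Q"
    using norm_triangle_ineq[of "(of_real s)\<^sup>2" "\<zeta> * \<xi>"] by (simp add: norm_mult norm_power)
  have "cauchy_kernel \<zeta> s - cauchy_kernel \<xi> s = (\<zeta> * B - \<xi> * A) / (A * B)"
    using AB by (simp add: cauchy_kernel_def A_def B_def divide_simps mult.commute)
  also have "\<zeta> * B - \<xi> * A = (\<zeta> - \<xi>) * ((of_real s)\<^sup>2 + \<zeta> * \<xi>)"
    by (simp add: A_def B_def power2_eq_square algebra_simps)
  finally have "norm (cauchy_kernel \<zeta> s - cauchy_kernel \<xi> s)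
      = norm (\<zeta> - \<xi>) * norm ((of_real s)\<^sup>2 + \<zeta> * \<xi>) * (1 / (norm A * norm B))"
    by (simp add: norm_mult norm_divide)
  also have "\<dots> \<le> norm (\<zeta> - \<xi>) * (4 * Q) * (c\<^sup>2 / Q\<^sup>2)"
    using num inv Q by (intro mult_mono) auto
  also have "\<dots> = 4 * c\<^sup>2 * norm (\<zeta> - \<xi>) / Q"
    using Q by (simp add: power2_eq_square)
  also have "c\<^sup>2 = (1 + 3 / \<delta>) ^ 4"
    by (simp add: c_def flip: power_mult)
  finally show ?thesis by (simp add: Q_def)
qed

text \<open>
  Two bounds, good for large and for small \<open>R\<close> respectively. For the first, \<open>ray_log R\<close> can be subtracted
  from \<open>ray_log\<close> because the difference of the kernels has integral \<open>0\<close>; without this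
  subtraction an additional factor \<open>ln R\<close> would appear, and the sum over \<open>n\<close> would be of order
  \<open>(ln (norm z))\<^sup>2\<close>, too large for the theorem. The second simply
  uses \<open>1 / (s\<^sup>2 + R\<^sup>2) \<le> 1 / s\<^sup>2\<close>.
\<close>
lemma ray_transform_diff_le:
  assumes "\<delta> > 0" "R > 0"
    and "\<delta> * R \<le> \<bar>Im \<zeta>\<bar>" "norm \<zeta> \<le> 2 * R"
    and "\<delta> * R \<le> \<bar>Im \<xi>\<bar>" "norm \<xi> \<le> 2 * R"
    and "sgn (Im \<zeta>) = sgn (Im \<xi>)"
  defines "C \<equiv> 4 * (1 + 3 / \<delta>) ^ 4"
  shows "norm (ray_transform \<zeta> - ray_transform \<xi>) \<le> C * norm (\<zeta> - \<xi>) / R"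
    and "norm (ray_transform \<zeta> - ray_transform \<xi>)
      \<le> C * norm (\<zeta> - \<xi>) * (LINT s:{0<..}|lborel. \<bar>ray_log s\<bar> / s\<^sup>2)"
proof -
  define D where "D = C * norm (\<zeta> - \<xi>)"
  have D: "D \<ge> 0" using assms by (simp add: D_def)
  have "\<delta> * R > 0" using assms by simp
  hence "\<bar>Im \<zeta>\<bar> > 0" "\<bar>Im \<xi>\<bar> > 0" using assms by linarith+
  hence Im: "Im \<zeta> \<noteq> 0" "Im \<xi> \<noteq> 0" by simp_all
  note iK = set_integrable_cauchy_kernel[OF Im(1)] set_integrable_cauchy_kernel[OF Im(2)]
  note ifK = set_integrable_ray_log_cauchy_kernel[OF Im(1)] set_integrable_ray_log_cauchy_kernel[OF Im(2)]
  define K where "K = (\<lambda>s. cauchy_kernel \<zeta> s - cauchy_kernel \<xi> s)"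
  have K_le: "norm (K s) \<le> D * (1 / (s\<^sup>2 + R\<^sup>2))" if "s \<in> {0<..}" for s
    using cauchy_kernel_diff_le[of \<delta> s R \<zeta> \<xi>] assms that by (simp add: K_def D_def C_def)
  have K_int: "set_integrable lborel {0<..} K"
    unfolding K_def using iK by (rule set_integral_diff)
  have K_0: "(LINT s:{0<..}|lborel. K s) = 0"
    unfolding K_def set_integral_diff(2)[OF iK] using Im assms(7) by (simp add: integral_cauchy_kernel)
  have fK: "(\<lambda>s. of_real (ray_log s) * K s)
      = (\<lambda>s. of_real (ray_log s) * cauchy_kernel \<zeta> s - of_real (ray_log s) * cauchy_kernel \<xi> s)"
    by (simp add: K_def right_diff_distrib)
  have fK_int: "set_integrable lborel {0<..} (\<lambda>s. of_real (ray_log s) * K s)"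
    unfolding fK using ifK by (rule set_integral_diff)
  have cK_int: "set_integrable lborel {0<..} (\<lambda>s. of_real (ray_log R) * K s)"
    using K_int by (rule set_integrable_mult_right)
  define T where "T = (LINT s:{0<..}|lborel. of_real (ray_log s) * K s)"
  have "ray_transform \<zeta> - ray_transform \<xi> = - (1 / (of_real pi * \<i>)) * T"
    unfolding T_def fK set_integral_diff(2)[OF ifK] ray_transform_def by (simp add: right_diff_distrib)
  hence T: "norm (ray_transform \<zeta> - ray_transform \<xi>) = norm T / pi"
    by (simp add: norm_mult norm_divide)

  have "norm T \<le> (LINT s:{0<..}|lborel. D * (\<bar>ray_log s\<bar> / s\<^sup>2))"
    unfolding T_def
  proof (rule norm_set_integral_le[OF fK_int set_integrable_mult_right])
    show "set_integrable lborel {0<..} (\<lambda>s. \<bar>ray_log s\<bar> / s\<^sup>2)"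
      by (rule set_integrable_ray_log_over_square)
    fix s :: real assume s: "s \<in> {0<..}"
    have "norm (of_real (ray_log s) * K s) \<le> \<bar>ray_log s\<bar> * (D * (1 / (s\<^sup>2 + R\<^sup>2)))"
      unfolding norm_mult norm_of_real using K_le[OF s] by (intro mult_left_mono) auto
    also have "\<dots> \<le> \<bar>ray_log s\<bar> * (D * (1 / s\<^sup>2))"
      using s D assms(2)
      by (intro mult_left_mono divide_left_mono mult_pos_pos add_pos_pos) auto
    finally show "norm (of_real (ray_log s) * K s) \<le> D * (\<bar>ray_log s\<bar> / s\<^sup>2)"
      by (simp add: mult.commute)
  qed
  also have "\<dots> = D * (LINT s:{0<..}|lborel. \<bar>ray_log s\<bar> / s\<^sup>2)"
    by (rule set_integral_mult_right)
  finally have "norm T \<le> \<dots>" .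
  moreover have "norm T / pi \<le> norm T / 1"
    using pi_ge_two by (intro divide_left_mono) auto
  ultimately show "norm (ray_transform \<zeta> - ray_transform \<xi>)
      \<le> C * norm (\<zeta> - \<xi>) * (LINT s:{0<..}|lborel. \<bar>ray_log s\<bar> / s\<^sup>2)"
    unfolding T D_def by simp

  have "T = (LINT s:{0<..}|lborel. of_real (ray_log s) * K s - of_real (ray_log R) * K s)"
    unfolding T_def set_integral_diff(2)[OF fK_int cK_int] by (simp add: K_0)
  also have "norm \<dots> \<le> (LINT s:{0<..}|lborel. D * majorant R s)"
  proof (rule norm_set_integral_le[OF _ set_integrable_mult_right])
    show "set_integrable lborel {0<..} (\<lambda>s. of_real (ray_log s) * K s - of_real (ray_log R) * K s)"
      using fK_int cK_int by (rule set_integral_diff)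
    show "set_integrable lborel {0<..} (majorant R)"
      using assms(2) by (rule majorant_integral)
    fix s :: real assume s: "s \<in> {0<..}"
    have "norm (of_real (ray_log s) * K s - of_real (ray_log R) * K s)
        = \<bar>ray_log s - ray_log R\<bar> * norm (K s)"
      unfolding left_diff_distrib[symmetric] of_real_diff[symmetric] norm_mult norm_of_real ..
    also have "\<dots> \<le> \<bar>ray_log s - ray_log R\<bar> * (D * (1 / (s\<^sup>2 + R\<^sup>2)))"
      using K_le[OF s] by (intro mult_left_mono) auto
    also have "\<dots> = D * (\<bar>ray_log s - ray_log R\<bar> / (s\<^sup>2 + R\<^sup>2))" by simp
    also have "\<dots> \<le> D * majorant R s"
    proof (cases "s = R")
      case True
      thus ?thesis using D assms(2) by (simp add: majorant_def)
    next
      case False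
      have "\<bar>s\<^sup>2 - R\<^sup>2\<bar> > 0" using False s assms(2) by (simp add: power2_eq_iff)
      moreover have "\<bar>s\<^sup>2 - R\<^sup>2\<bar> \<le> s\<^sup>2 + R\<^sup>2" using abs_triangle_ineq4[of "s\<^sup>2" "R\<^sup>2"] by simp
      ultimately have "\<bar>ray_log s - ray_log R\<bar> / (s\<^sup>2 + R\<^sup>2) \<le> \<bar>ray_log s - ray_log R\<bar> / \<bar>s\<^sup>2 - R\<^sup>2\<bar>"
        by (intro divide_left_mono mult_pos_pos) auto
      also have "\<dots> \<le> majorant R s"
        using s assms(2) by (intro ray_log_quotient_le_majorant) auto
      finally show ?thesis using D by (intro mult_left_mono)
    qed
    finally show "norm (of_real (ray_log s) * K s - of_real (ray_log R) * K s) \<le> D * majorant R s" .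
  qed
  also have "\<dots> = D * (pi / R)"
    using assms(2) by (simp add: majorant_integral)
  finally have "norm T / pi \<le> D / R" by (simp add: field_simps)
  thus "norm (ray_transform \<zeta> - ray_transform \<xi>) \<le> C * norm (\<zeta> - \<xi>) / R"
    unfolding T D_def .
qed

section \<open>The BPS integrals as values of the transform\<close>

text \<open>
  Substitute \<open>w = v * s\<close> with \<open>v = - \<i> * (t + of_int n)\<close>; then \<open>\<zeta> = z / v\<close>.
\<close>
lemma I_BPS_eq_ray_transform:
  assumes "t + of_int n \<noteq> 0"
  shows "I_BPS t z n = ray_transform (\<i> * z / (t + of_int n))"
proof -
  define v where "v = - \<i> * (t + of_int n)"
  have v: "v \<noteq> 0" using assms by (simp add: v_def)
  have zv: "\<i> * z / (t + of_int n) = z / v"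
  proof -
    have "\<i> * v = t + of_int n" by (simp add: v_def flip: mult.assoc)
    thus ?thesis by (metis complex_i_not_zero mult_divide_mult_cancel_left)
  qed
  have integrand: "Ln (1 - exp (2 * of_real pi * \<i> * (t + of_int n) / (of_real s * v)))
        / ((of_real s * v)\<^sup>2 - z\<^sup>2) * v * z
      = of_real (ray_log s) * cauchy_kernel (z / v) s" if s: "s > 0" for s :: real
  proof -
    have "2 * of_real pi * \<i> * (t + of_int n) / (of_real s * v) = of_real (- 2 * pi / s)"
      using assms s by (simp add: v_def divide_simps)
    hence "1 - exp (2 * of_real pi * \<i> * (t + of_int n) / (of_real s * v))
        = of_real (1 - exp (- 2 * pi / s))"
      by (simp only: exp_of_real of_real_diff of_real_1)
    hence "Ln (1 - exp (2 * of_real pi * \<i> * (t + of_int n) / (of_real s * v))) = of_real (ray_log s)"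
      using exp_ray_less_1[OF s] by (simp only: ray_log_def) (intro Ln_of_real; simp)
    moreover have "(of_real s)\<^sup>2 - (z / v)\<^sup>2 = ((of_real s * v)\<^sup>2 - z\<^sup>2) / v\<^sup>2"
      using v by (simp add: field_simps)
    hence "cauchy_kernel (z / v) s = z * v / ((of_real s * v)\<^sup>2 - z\<^sup>2)"
      using v by (simp add: cauchy_kernel_def power2_eq_square)
    ultimately show ?thesis by simp
  qed
  have "I_BPS t z n = - (1 / (of_real pi * \<i>)) *
      (LINT s:{0<..}|lborel. Ln (1 - exp (2 * of_real pi * \<i> * (t + of_int n) / (of_real s * v)))
        / ((of_real s * v)\<^sup>2 - z\<^sup>2) * v * z)"
    unfolding I_BPS_def ray_integral_def v_def[symmetric] set_integral_mult_left by simp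
  also have "(LINT s:{0<..}|lborel. Ln (1 - exp (2 * of_real pi * \<i> * (t + of_int n) / (of_real s * v)))
        / ((of_real s * v)\<^sup>2 - z\<^sup>2) * v * z)
      = (LINT s:{0<..}|lborel. of_real (ray_log s) * cauchy_kernel (z / v) s)"
    using integrand by (intro set_lebesgue_integral_cong) auto
  finally show ?thesis by (simp only: ray_transform_def zv)
qed

section \<open>A series with logarithmic sum\<close>

lemma logarithmic_telescope:
  fixes x M :: real
  assumes "x > 0" "M > 0"
  shows "M / ((x + 1) * (x + M)) \<le> ln (1 + M / x) - ln (1 + M / (x + 1))"
proof -
  have p: "1 + M / x > 0" "1 + M / (x + 1) > 0"
    using assms by (auto intro!: add_pos_pos divide_pos_pos)
  have "(1 + M / (x + 1)) / (1 + M / x) = ((x + 1 + M) / (x + 1)) / ((x + M) / x)"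
    using assms by (simp add: add_divide_distrib)
  also have "\<dots> = ((x + 1) * (x + M) - M) / ((x + 1) * (x + M))"
    using assms by (simp add: algebra_simps)
  also have "\<dots> = 1 - M / ((x + 1) * (x + M))"
    using assms by (simp add: diff_divide_distrib)
  finally have ratio: "(1 + M / (x + 1)) / (1 + M / x) = 1 - M / ((x + 1) * (x + M))" .
  have "ln (1 + M / (x + 1)) - ln (1 + M / x) = ln ((1 + M / (x + 1)) / (1 + M / x))"
    using p by (simp add: ln_div)
  also have "\<dots> \<le> (1 + M / (x + 1)) / (1 + M / x) - 1"
    using p by (intro ln_le_minus_one divide_pos_pos)
  finally show ?thesis unfolding ratio by simp
qed

text \<open>
  The minimum of \<open>1 / n\<close> and \<open>M / n\<^sup>2\<close> is at most \<open>2 * M / (n * (n + M))\<close>, which is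
  essentially minus the derivative of \<open>ln (1 + M / n)\<close> in \<open>n\<close>. So a series with such terms
  converges, and its sum is logarithmic in \<open>M\<close>.
\<close>
lemma le_logarithmic_telescope:
  fixes a n M E :: real
  assumes "n \<ge> 1" "M > 0" "a \<le> E / n" "a \<le> E * M / n\<^sup>2" "E \<ge> 0"
  shows "a \<le> 4 * E * (ln (1 + M / n) - ln (1 + M / (n + 1)))"
proof -
  have "a \<le> E * (2 * M / (n * (n + M)))"
  proof (cases "n \<le> M")
    case True
    have "a \<le> E * (1 / n)" using assms by simp
    also have "\<dots> \<le> E * (2 * M / (n * (n + M)))"
      using assms True by (intro mult_left_mono) (auto simp: divide_simps)
    finally show ?thesis .
  next
    case False
    have "a \<le> (E * M / n) * (1 / n)" using assms by (simp add: power2_eq_square)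
    also have "\<dots> \<le> (E * M / n) * (2 / (n + M))"
      using assms False by (intro mult_left_mono) (auto simp: divide_simps)
    also have "\<dots> = E * (2 * M / (n * (n + M)))" by simp
    finally show ?thesis .
  qed
  also have "\<dots> \<le> E * (4 * (M / ((n + 1) * (n + M))))"
  proof (intro mult_left_mono assms)
    have "1 / n \<le> 2 / (n + 1)" using assms by (simp add: divide_simps)
    hence "(2 * M / (n + M)) * (1 / n) \<le> (2 * M / (n + M)) * (2 / (n + 1))"
      using assms by (intro mult_left_mono) auto
    thus "2 * M / (n * (n + M)) \<le> 4 * (M / ((n + 1) * (n + M)))"
      by (simp add: mult.commute)
  qed
  also have "\<dots> \<le> E * (4 * (ln (1 + M / n) - ln (1 + M / (n + 1))))"
    using assms by (intro mult_left_mono logarithmic_telescope) auto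
  finally show ?thesis by (simp add: algebra_simps)
qed

section \<open>Sectors without BPS rays\<close>

lemma sector_is_cone:
  assumes "is_sector S" "z \<in> S" "r > 0"
  shows "of_real r * z \<in> S"
proof -
  obtain J a where S: "S = {of_real r * cis \<theta> | r \<theta>. r > 0 \<and> \<theta> \<in> J}"
    using assms(1) unfolding is_sector_def by blast
  then obtain \<rho> \<theta> where z: "z = of_real \<rho> * cis \<theta>" "\<rho> > 0" "\<theta> \<in> J"
    using assms(2) by blast
  have "of_real r * z = of_real (r * \<rho>) * cis \<theta>" by (simp add: z)
  thus ?thesis unfolding S using z assms(3) by (blast intro: mult_pos_pos)
qed

lemma sector_nonzero:
  assumes "is_sector S" "z \<in> S"
  shows "z \<noteq> 0"
  using assms unfolding is_sector_def by auto

lemma sector_avoids_line: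
  assumes S: "is_sector S" "z \<in> S" and "\<not> ray v \<subseteq> S" "\<not> ray (- v) \<subseteq> S"
  shows "z \<noteq> of_real c * v"
proof
  assume z: "z = of_real c * v"
  have sub: "ray u \<subseteq> S" if "z = of_real d * u" "d > 0" for d u
  proof
    fix w assume "w \<in> ray u"
    then obtain s where s: "s > 0" "w = of_real s * u" by (auto simp: ray_def)
    hence "w = of_real (s / d) * z" using that by simp
    thus "w \<in> S" using sector_is_cone[OF S, of "s / d"] s that by simp
  qed
  have "c \<noteq> 0" using z sector_nonzero[OF S] by auto
  thus False
    using sub[of c v] sub[of "- c" "- v"] z assms(3,4) by (cases "c > 0") auto
qed

lemma bps_ray_mem:
  "ray (\<i> * (t + of_int n)) \<in> bps_rays t" "ray (- (\<i> * (t + of_int n))) \<in> bps_rays t"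
  "ray \<i> \<in> bps_rays t" "ray (- \<i>) \<in> bps_rays t"
  by (auto simp: bps_rays_def)

text \<open>
  The directions \<open>\<plusminus>\<i>\<close> are excluded, so every \<open>z\<close> in \<open>S\<close> has a slope \<open>Im z / Re z\<close>, and
  the set of slopes is connected. The excluded rays \<open>\<plusminus>\<i> * (t + n)\<close> have the slopes
  \<open>(Re t + n) / (- Im t)\<close>, which are equally spaced and unbounded in both directions. Hence the slopes of
  \<open>S\<close> lie between two of these: \<open>S\<close> keeps a positive angle to the imaginary axis, where
  the BPS rays accumulate.
\<close>
lemma sector_slope_bounded:
  assumes "Im t \<noteq> 0" "is_sector S" and free: "\<forall>\<rho>\<in>bps_rays t. \<not> \<rho> \<subseteq> S"
  obtains B where "B \<ge> 0" "\<And>z. z \<in> S \<Longrightarrow> \<bar>Im z\<bar> \<le> B * \<bar>Re z\<bar>"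
proof -
  obtain J a where J: "is_interval J" "interior J \<noteq> {}"
    and S: "S = {of_real r * cis \<theta> | r \<theta>. r > 0 \<and> \<theta> \<in> J}"
    using assms(2) unfolding is_sector_def by blast
  have cis_S: "cis \<theta> \<in> S" if "\<theta> \<in> J" for \<theta>
  proof -
    have "cis \<theta> = of_real 1 * cis \<theta>" by simp
    thus ?thesis unfolding S using that zero_less_one
      by (intro CollectI exI[of _ "1::real"] exI[of _ \<theta>] conjI)
  qed
  have cos: "cos \<theta> \<noteq> 0" if "\<theta> \<in> J" for \<theta>
  proof
    assume "cos \<theta> = 0"
    hence "cis \<theta> = of_real (sin \<theta>) * \<i>" by (simp add: complex_eq_iff)
    moreover have "cis \<theta> \<noteq> of_real (sin \<theta>) * \<i>"
      using free bps_ray_mem by (intro sector_avoids_line[OF assms(2) cis_S[OF that]]) auto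
    ultimately show False by contradiction
  qed
  define M where "M = (\<lambda>\<theta>. sin \<theta> / cos \<theta>) ` J"
  define p where "p = (\<lambda>n::int. (Re t + of_int n) / (- Im t))"
  have conn: "connected M"
    unfolding M_def using J(1) cos
    by (intro connected_continuous_image continuous_intros) (auto simp: is_interval_connected)
  have p_notin: "p n \<notin> M" for n
  proof
    assume "p n \<in> M"
    then obtain \<theta> where \<theta>: "\<theta> \<in> J" "p n = sin \<theta> / cos \<theta>" by (auto simp: M_def)
    have "sin \<theta> = p n * cos \<theta>" using \<theta> cos by simp
    hence "cis \<theta> = of_real (cos \<theta> / (- Im t)) * (\<i> * (t + of_int n))"
      using assms(1) by (simp add: complex_eq_iff p_def)
    moreover have "cis \<theta> \<noteq> of_real (cos \<theta> / (- Im t)) * (\<i> * (t + of_int n))"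
      using free bps_ray_mem by (intro sector_avoids_line[OF assms(2) cis_S[OF \<theta>(1)]]) auto
    ultimately show False by contradiction
  qed
  obtain m0 where m0: "m0 \<in> M"
    using J(2) interior_subset[of J] by (auto simp: M_def)
  have up: "\<exists>n. y < p n" for y
  proof (cases "Im t < 0")
    case True
    obtain n where "y * (- Im t) - Re t < of_int n" using ex_less_of_int by blast
    thus ?thesis using True by (intro exI[of _ n]) (simp add: p_def field_simps)
  next
    case False
    obtain n where "of_int n < y * (- Im t) - Re t" using ex_of_int_less by blast
    thus ?thesis using False assms(1) by (intro exI[of _ n]) (simp add: p_def field_simps)
  qed
  have down: "\<exists>n. p n < y" for y
  proof (cases "Im t < 0")
    case True
    obtain n where "of_int n < y * (- Im t) - Re t" using ex_of_int_less by blast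
    thus ?thesis using True by (intro exI[of _ n]) (simp add: p_def field_simps)
  next
    case False
    obtain n where "y * (- Im t) - Re t < of_int n" using ex_less_of_int by blast
    thus ?thesis using False assms(1) by (intro exI[of _ n]) (simp add: p_def field_simps)
  qed
  \<comment> \<open>the two excluded slopes around \<open>m0\<close> trap the connected set \<open>M\<close>\<close>
  obtain n1 n2 where n: "p n1 < m0" "m0 < p n2" using up down by blast
  have M_bd: "p n1 < m \<and> m < p n2" if m: "m \<in> M" for m
    using connected_contains_Icc[OF conn m m0] connected_contains_Icc[OF conn m0 m]
      p_notin[of n1] p_notin[of n2] n
    by (meson atLeastAtMost_iff less_imp_le not_less subsetD)
  define B where "B = max \<bar>p n1\<bar> \<bar>p n2\<bar>"
  show ?thesis
  proof
    show "B \<ge> 0" by (simp add: B_def)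
    fix z assume "z \<in> S"
    then obtain r \<theta> where z: "z = of_real r * cis \<theta>" "r > 0" "\<theta> \<in> J" unfolding S by blast
    have "sin \<theta> / cos \<theta> \<in> M" using z(3) by (simp add: M_def)
    hence "\<bar>sin \<theta> / cos \<theta>\<bar> \<le> B" using M_bd unfolding B_def by fastforce
    hence "\<bar>sin \<theta>\<bar> \<le> B * \<bar>cos \<theta>\<bar>" using cos[OF z(3)] by (simp add: field_simps)
    hence "r * \<bar>sin \<theta>\<bar> \<le> r * (B * \<bar>cos \<theta>\<bar>)" using z(2) by (intro mult_left_mono) auto
    thus "\<bar>Im z\<bar> \<le> B * \<bar>Re z\<bar>" using z(2) by (simp add: z(1) abs_mult algebra_simps)
  qed
qed

section \<open>Estimates for the BPS integrals\<close>

text \<open>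
  Since \<open>\<zeta> * n = \<i> * z - \<zeta> * u\<close>, the point \<open>\<zeta>\<close> is \<open>\<i> * z / n\<close> up to a
  perturbation of relative size \<open>norm u / n\<close>. The latter number has imaginary part
  \<open>Re z / n\<close>, which the slope bound keeps away from \<open>0\<close>.
\<close>
lemma translated_point_in_sector:
  fixes z u :: complex and n B :: real
  assumes "B \<ge> 0" "\<bar>Im z\<bar> \<le> B * \<bar>Re z\<bar>" "z \<noteq> 0" "n > 0" "4 * (1 + B) * norm u \<le> n"
  defines "\<zeta> \<equiv> \<i> * z / (of_real n + u)" and "R \<equiv> norm z / n"
  shows "n / 2 \<le> norm (of_real n + u)" "norm \<zeta> \<le> 2 * R"
    "1 / (2 * (1 + B)) * R \<le> \<bar>Im \<zeta>\<bar>" "sgn (Im \<zeta>) = sgn (Re z)"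
proof -
  have "4 * 1 * norm u \<le> 4 * (1 + B) * norm u"
    using assms(1) by (intro mult_right_mono) auto
  hence u: "norm u \<le> n / 4" using assms(5) by simp
  have "n - norm u \<le> norm (of_real n + u)"
    using norm_diff_ineq[of "of_real n" u] assms(4) by simp
  thus den: "n / 2 \<le> norm (of_real n + u)" using u assms(4) by simp
  have ne: "of_real n + u \<noteq> 0" using den assms(4) by auto
  have "norm \<zeta> = norm z / norm (of_real n + u)" by (simp add: \<zeta>_def norm_divide norm_mult)
  also have "\<dots> \<le> norm z / (n / 2)"
    using den assms(4) ne by (intro divide_left_mono) auto
  finally show \<zeta>: "norm \<zeta> \<le> 2 * R" by (simp add: R_def mult.commute)
  have Rez: "norm z / (1 + B) \<le> \<bar>Re z\<bar>"
    using cmod_le[of z] assms(1,2) by (simp add: field_simps)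
  have "\<bar>Im (\<zeta> * u)\<bar> \<le> norm \<zeta> * norm u"
    using abs_Im_le_cmod[of "\<zeta> * u"] by (simp add: norm_mult)
  also have "\<dots> \<le> 2 * R * (n / (4 * (1 + B)))"
    using \<zeta> assms(1,4,5) by (intro mult_mono) (auto simp: R_def field_simps)
  also have "\<dots> = norm z / (1 + B) / 2"
    using assms(1,4) by (simp add: R_def divide_simps) (simp add: algebra_simps)?
  finally have small: "\<bar>Im (\<zeta> * u)\<bar> \<le> norm z / (1 + B) / 2" .
  \<comment> \<open>at most half of \<open>Re z\<close> can be cancelled by the perturbation\<close>
  have "\<zeta> * (of_real n + u) = \<i> * z" using ne by (simp add: \<zeta>_def)
  hence "Im (\<zeta> * of_real n + \<zeta> * u) = Re z" by (simp add: algebra_simps)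
  hence eq: "n * Im \<zeta> = Re z - Im (\<zeta> * u)" by (simp add: algebra_simps)
  define P where "P = norm z / (1 + B)"
  have pos: "norm z / (1 + B) > 0" using assms(1,3) by simp
  have "norm z / (1 + B) / 2 \<le> \<bar>n * Im \<zeta>\<bar>"
    unfolding eq using small Rez unfolding P_def[symmetric] by linarith
  also have "\<dots> = n * \<bar>Im \<zeta>\<bar>" using assms(4) by (simp add: abs_mult)
  finally have lower: "norm z / (1 + B) / 2 \<le> n * \<bar>Im \<zeta>\<bar>" .
  show "1 / (2 * (1 + B)) * R \<le> \<bar>Im \<zeta>\<bar>"
  proof -
    have "norm z / (1 + B) / 2 / n \<le> n * \<bar>Im \<zeta>\<bar> / n"
      using lower assms(4) by (intro divide_right_mono) auto
    moreover have "norm z / (1 + B) / 2 / n = 1 / (2 * (1 + B)) * R"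
      by (simp add: R_def mult.commute)
    moreover have "n * \<bar>Im \<zeta>\<bar> / n = \<bar>Im \<zeta>\<bar>" using assms(4) by simp
    ultimately show ?thesis by argo
  qed
  have "sgn (n * Im \<zeta>) = sgn (Re z)"
  proof -
    have "\<bar>Im (\<zeta> * u)\<bar> < \<bar>Re z\<bar>"
      using small Rez pos unfolding P_def[symmetric] by linarith
    moreover have "sgn (x - y) = sgn x" if "\<bar>y\<bar> < \<bar>x\<bar>" for x y :: real
      using that by (cases x "0 :: real" rule: linorder_cases) (simp_all add: sgn_if abs_less_iff)
    ultimately show ?thesis unfolding eq by blast
  qed
  thus "sgn (Im \<zeta>) = sgn (Re z)" using assms(4) by (simp add: sgn_mult)
qed

text \<open>
  As \<open>ray_transform\<close> is odd, the sum is the difference of its values at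
  \<open>\<zeta> = \<i> * z / (n + t)\<close> and \<open>\<xi> = \<i> * z / (n - t)\<close>. These points lie in the same
  half plane, both have size about \<open>R = norm z / n\<close>, and their distance is of order
  \<open>norm z / n\<^sup>2 = R / n\<close>.
\<close>
lemma BPS_pair_bound:
  assumes "Im t \<noteq> 0" "B \<ge> 0"
  obtains E where "E \<ge> 0"
    "\<And>z n. \<lbrakk>\<bar>Im z\<bar> \<le> B * \<bar>Re z\<bar>; z \<noteq> 0; n > 0; 4 * (1 + B) * norm t \<le> real n\<rbrakk> \<Longrightarrow>
      norm (I_BPS t z (int n) + I_BPS t z (- int n)) \<le> E / real n \<and>
      norm (I_BPS t z (int n) + I_BPS t z (- int n)) \<le> E * norm z / (real n)\<^sup>2"
proof -
  define \<delta> where "\<delta> = 1 / (2 * (1 + B))"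
  define C where "C = 4 * (1 + 3 / \<delta>) ^ 4"
  define F where "F = (LINT s:{0<..}|lborel. \<bar>ray_log s\<bar> / s\<^sup>2)"
  define E where "E = 8 * C * norm t * (1 + F)"
  have \<delta>: "\<delta> > 0" using assms by (simp add: \<delta>_def)
  have C: "C \<ge> 0" by (simp add: C_def)
  have F: "F \<ge> 0"
    unfolding F_def set_lebesgue_integral_def by (intro integral_nonneg_AE AE_I2) auto
  show ?thesis
  proof
    show "E \<ge> 0" using C F by (simp add: E_def)
    fix z :: complex and n :: nat
    assume z: "\<bar>Im z\<bar> \<le> B * \<bar>Re z\<bar>" "z \<noteq> 0" and n: "n > 0" "4 * (1 + B) * norm t \<le> real n"
    define \<zeta> \<xi> where "\<zeta> = \<i> * z / (of_real (real n) + t)" and "\<xi> = \<i> * z / (of_real (real n) + (- t))"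
    define R where "R = norm z / real n"
    have n0: "real n > 0" using n by simp
    have R: "R > 0" using z n by (simp add: R_def)
    note A = translated_point_in_sector[OF assms(2) z n0 n(2), folded \<zeta>_def R_def \<delta>_def]
    have n2: "4 * (1 + B) * norm (- t) \<le> real n" using n(2) by simp
    note A' = translated_point_in_sector[OF assms(2) z n0 n2, folded \<xi>_def R_def \<delta>_def]
    have "I_BPS t z (int n) = ray_transform \<zeta>"
      using assms(1) by (subst I_BPS_eq_ray_transform) (auto simp: \<zeta>_def complex_eq_iff add.commute)
    moreover have "I_BPS t z (- int n) = ray_transform (- \<xi>)"
    proof -
      have "\<i> * z / (t + of_int (- int n)) = - \<xi>"
        unfolding \<xi>_def by (simp add: minus_divide_right)
      moreover have "t + of_int (- int n) \<noteq> 0"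
        using assms(1) by (auto simp: complex_eq_iff)
      ultimately show ?thesis by (metis I_BPS_eq_ray_transform)
    qed
    ultimately have sum: "I_BPS t z (int n) + I_BPS t z (- int n) = ray_transform \<zeta> - ray_transform \<xi>"
      by (simp add: ray_transform_minus)
    have ne: "of_real (real n) + t \<noteq> 0" "of_real (real n) + (- t) \<noteq> 0"
      using A(1) A'(1) n0 by auto
    have "\<zeta> - \<xi> = \<i> * z * (- 2 * t) / ((of_real (real n) + t) * (of_real (real n) + (- t)))"
      unfolding \<zeta>_def \<xi>_def diff_frac_eq[OF ne] by (simp add: algebra_simps)
    hence "norm (\<zeta> - \<xi>) = 2 * norm t * norm z / (norm (of_real (real n) + t) * norm (of_real (real n) + (- t)))"
      by (simp add: norm_mult norm_divide)
    also have "\<dots> \<le> 2 * norm t * norm z / ((real n / 2) * (real n / 2))"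
      using A(1) A'(1) n0 ne by (intro divide_left_mono mult_mono mult_pos_pos) auto
    also have "\<dots> = 8 * norm t * norm z / (real n)\<^sup>2" by (simp add: power2_eq_square)
    finally have diff: "norm (\<zeta> - \<xi>) \<le> 8 * norm t * norm z / (real n)\<^sup>2" .
    have sg: "sgn (Im \<zeta>) = sgn (Im \<xi>)" using A(4) A'(4) by simp
    note L = ray_transform_diff_le[OF \<delta> R A(3,2) A'(3,2) sg, folded C_def F_def]
    have "norm (ray_transform \<zeta> - ray_transform \<xi>) \<le> C * (8 * norm t * norm z / (real n)\<^sup>2) / R"
      using diff C R by (intro order.trans[OF L(1)] divide_right_mono mult_left_mono) auto
    also have "\<dots> = 8 * C * norm t * 1 / real n"
      using z n0 by (simp add: R_def power2_eq_square)
    also have "\<dots> \<le> E / real n"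
      unfolding E_def using C F n0 by (intro divide_right_mono mult_left_mono) auto
    finally have 1: "norm (ray_transform \<zeta> - ray_transform \<xi>) \<le> E / real n" .
    have "norm (ray_transform \<zeta> - ray_transform \<xi>) \<le> C * (8 * norm t * norm z / (real n)\<^sup>2) * F"
      using diff C F by (intro order.trans[OF L(2)] mult_right_mono mult_left_mono) auto
    also have "\<dots> = 8 * C * norm t * F * norm z / (real n)\<^sup>2" by simp
    also have "\<dots> \<le> E * norm z / (real n)\<^sup>2"
      unfolding E_def using C F by (intro divide_right_mono mult_right_mono mult_left_mono) auto
    finally have 2: "norm (ray_transform \<zeta> - ray_transform \<xi>) \<le> E * norm z / (real n)\<^sup>2" .
    show "norm (I_BPS t z (int n) + I_BPS t z (- int n)) \<le> E / real n \<and>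
      norm (I_BPS t z (int n) + I_BPS t z (- int n)) \<le> E * norm z / (real n)\<^sup>2"
      unfolding sum using 1 2 by blast
  qed
qed

text \<open>
  A point of \<open>S\<close> on the line through the \<open>n\<close>-th BPS rays is impossible, so \<open>\<zeta>\<close> is not real.
  The bound holds throughout \<open>S\<close>, even if \<open>S\<close> is bounded by the \<open>n\<close>-th ray.
\<close>
lemma I_BPS_bound:
  assumes "Im t \<noteq> 0" "is_sector S" "\<forall>\<rho>\<in>bps_rays t. \<not> \<rho> \<subseteq> S" "z \<in> S" "norm z \<ge> 1"
  shows "norm (I_BPS t z n) \<le> \<bar>ray_log 1\<bar> + 1 + \<bar>ln (norm (t + of_int n))\<bar> + ln (norm z)"
proof -
  define v where "v = t + of_int n"
  have v: "v \<noteq> 0" using assms(1) by (auto simp: v_def complex_eq_iff)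
  define \<zeta> where "\<zeta> = \<i> * z / v"
  have z: "z \<noteq> 0" using assms(5) by auto
  have "Im \<zeta> \<noteq> 0"
  proof
    assume "Im \<zeta> = 0"
    hence "\<zeta> = of_real (Re \<zeta>)" by (simp add: complex_eq_iff)
    hence "of_real (- Re \<zeta>) * (\<i> * v) = - \<zeta> * (\<i> * v)" by simp
    also have "\<dots> = - (\<i> * \<i>) * z"
      unfolding \<zeta>_def using v by (simp only: minus_mult_left[symmetric] times_divide_eq_left mult_ac) simp
    finally have "z = of_real (- Re \<zeta>) * (\<i> * v)" by simp
    moreover have "z \<noteq> of_real (- Re \<zeta>) * (\<i> * v)"
      unfolding v_def using assms(3) bps_ray_mem
      by (intro sector_avoids_line[OF assms(2,4)]) auto
    ultimately show False by contradiction
  qed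
  hence "norm (ray_transform \<zeta>) \<le> \<bar>ray_log (norm \<zeta>)\<bar> + 1" by (rule norm_ray_transform_le)
  also have "\<bar>ray_log (norm \<zeta>)\<bar> \<le> \<bar>ray_log 1\<bar> + \<bar>ln (norm \<zeta>)\<bar>"
    using z v by (intro abs_ray_log_le) (simp add: \<zeta>_def)
  also have "ln (norm \<zeta>) = ln (norm z) - ln (norm v)"
    using z v by (simp add: \<zeta>_def norm_divide norm_mult ln_div)
  also have "\<bar>ln (norm z) - ln (norm v)\<bar> \<le> ln (norm z) + \<bar>ln (norm v)\<bar>"
    using abs_triangle_ineq4[of "ln (norm z)" "ln (norm v)"] assms(5) by simp
  finally show ?thesis
    using I_BPS_eq_ray_transform[of t n z] v by (simp add: v_def \<zeta>_def)
qed

text \<open>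
  Finitely many pairs, up to an index \<open>N\<close> that does not depend on \<open>z\<close>, are estimated term by
  term; the others form a telescoping series with sum of order \<open>ln (1 + norm z)\<close>.
\<close>
lemma log_X_inst_bound:
  assumes "Im t \<noteq> 0" "is_sector S" "\<forall>\<rho>\<in>bps_rays t. \<not> \<rho> \<subseteq> S"
  obtains a b where "b \<ge> 0"
    "\<And>z. z \<in> S \<Longrightarrow> norm z \<ge> 1 \<Longrightarrow> norm (log_X_inst t z) \<le> a + b * ln (norm z)"
proof -
  obtain B where B: "B \<ge> 0" "\<And>z. z \<in> S \<Longrightarrow> \<bar>Im z\<bar> \<le> B * \<bar>Re z\<bar>"
    using sector_slope_bounded[OF assms] by blast
  obtain E where E: "E \<ge> 0"
    "\<And>z n. \<lbrakk>\<bar>Im z\<bar> \<le> B * \<bar>Re z\<bar>; z \<noteq> 0; n > 0; 4 * (1 + B) * norm t \<le> real n\<rbrakk> \<Longrightarrow>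
      norm (I_BPS t z (int n) + I_BPS t z (- int n)) \<le> E / real n \<and>
      norm (I_BPS t z (int n) + I_BPS t z (- int n)) \<le> E * norm z / (real n)\<^sup>2"
    using BPS_pair_bound[OF assms(1) B(1)] by metis
  \<comment> \<open>from this index on the pairs satisfy the hypothesis of the pair bound\<close>
  define N where "N = nat \<lceil>4 * (1 + B) * norm t\<rceil>"
  define q where "q n = \<bar>ray_log 1\<bar> + 1 + \<bar>ln (norm (t + of_int n))\<bar>" for n :: int
  define Q where "Q = (\<Sum>k<N. q (int (Suc k)) + q (- int (Suc k)))"
  have q: "q n \<ge> 0" for n by (simp add: q_def)
  show ?thesis
  proof
    show "1 + 2 * real N + 4 * E \<ge> 0" using E by simp
    fix z assume z: "z \<in> S" "norm z \<ge> 1"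
    define M L where "M = norm z" and "L = ln (norm z)"
    have M: "M \<ge> 1" and L: "L \<ge> 0" using z by (auto simp: M_def L_def)
    have I: "norm (I_BPS t z n) \<le> q n + L" for n
      using I_BPS_bound[OF assms z] by (simp add: q_def L_def)
    define \<phi> where "\<phi> k = ln (1 + M / (real k + 1))" for k
    have \<phi>_mono: "\<phi> (Suc k) \<le> \<phi> k" for k
      unfolding \<phi>_def using M
      by (intro ln_mono add_left_mono divide_left_mono) (auto intro!: add_pos_nonneg)
    define a where "a k = I_BPS t z (int (Suc k)) + I_BPS t z (- int (Suc k))" for k
    define g where "g k = (if k < N then q (int (Suc k)) + q (- int (Suc k)) + 2 * L else 0)" for k
    define h where "h k = 4 * E * (\<phi> k - \<phi> (Suc k))" for k
    have h: "h k \<ge> 0" for k using E \<phi>_mono by (simp add: h_def)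
    have g: "g k \<ge> 0" for k using q L by (simp add: g_def)
    have a_le: "norm (a k) \<le> g k + h k" for k
    proof (cases "k < N")
      case True
      have "norm (a k) \<le> (q (int (Suc k)) + L) + (q (- int (Suc k)) + L)"
        unfolding a_def by (intro order.trans[OF norm_triangle_ineq] add_mono I)
      also have "\<dots> = g k" using True by (simp add: g_def)
      finally show ?thesis using h[of k] by simp
    next
      case False
      have "4 * (1 + B) * norm t \<le> real (Suc k)"
        using False unfolding N_def by linarith
      hence E': "norm (a k) \<le> E / real (Suc k)" "norm (a k) \<le> E * M / (real (Suc k))\<^sup>2"
        unfolding a_def M_def
        using E(2)[OF B(2)[OF z(1)] sector_nonzero[OF assms(2) z(1)], of "Suc k"] by blast+
      have "norm (a k) \<le> 4 * E * (ln (1 + M / real (Suc k)) - ln (1 + M / (real (Suc k) + 1)))"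
        using M E(1) E' by (intro le_logarithmic_telescope) auto
      also have "\<dots> = h k" by (simp add: h_def \<phi>_def add.commute)
      finally show ?thesis using g[of k] by simp
    qed
    have "(\<lambda>k. M / (real k + 1)) \<longlonglongrightarrow> 0"
      using LIMSEQ_Suc[OF lim_const_over_n[of M]] by (simp add: add.commute)
    hence "\<phi> \<longlonglongrightarrow> ln (1 + 0)"
      unfolding \<phi>_def by (intro tendsto_intros) auto
    hence "(\<lambda>k. \<phi> k - \<phi> (Suc k)) sums (\<phi> 0 - 0)"
      by (intro telescope_sums') simp
    hence h_sums: "h sums (4 * E * \<phi> 0)"
      unfolding h_def by (intro sums_mult) simp
    have g_sums: "g sums (\<Sum>k<N. q (int (Suc k)) + q (- int (Suc k)) + 2 * L)"
      unfolding g_def using sums_If_finite_set[of "{..<N}" "\<lambda>k. q (int (Suc k)) + q (- int (Suc k)) + 2 * L"]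
      by (simp only: lessThan_iff finite_lessThan)
    have gh: "(\<lambda>k. g k + h k) sums ((Q + 2 * real N * L) + 4 * E * \<phi> 0)"
      using sums_add[OF g_sums h_sums] by (simp add: Q_def sum.distrib algebra_simps)
    have "norm (suminf a) \<le> (\<Sum>k. g k + h k)"
      using a_le sums_summable[OF gh] by (rule norm_suminf_le)
    also have "\<dots> = Q + 2 * real N * L + 4 * E * \<phi> 0"
      using sums_unique[OF gh] by simp
    finally have tail: "norm (suminf a) \<le> Q + 2 * real N * L + 4 * E * \<phi> 0" .
    have "\<phi> 0 \<le> ln (2 * M)"
      unfolding \<phi>_def using M by (intro ln_mono) auto
    also have "\<dots> = ln 2 + L" using M by (simp add: ln_mult_pos L_def flip: M_def)
    finally have \<phi>0: "4 * E * \<phi> 0 \<le> 4 * E * (ln 2 + L)" using E(1) by (intro mult_left_mono) auto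
    have "norm (log_X_inst t z) \<le> norm (I_BPS t z 0) + norm (suminf a)"
      unfolding log_X_inst_def a_def by (rule norm_triangle_ineq)
    also have "\<dots> \<le> (q 0 + L) + (Q + 2 * real N * L + 4 * E * (ln 2 + L))"
      using I[of 0] tail \<phi>0 by linarith
    also have "\<dots> = (q 0 + Q + 4 * E * ln 2) + (1 + 2 * real N + 4 * E) * L"
      by (simp add: algebra_simps)
    finally show "norm (log_X_inst t z) \<le> (q 0 + Q + 4 * E * ln 2) + (1 + 2 * real N + 4 * E) * ln (norm z)"
      by (simp add: L_def)
  qed
qed

section \<open>Polynomial growth\<close>

theorem proposition43:
  fixes t :: complex and l S :: "complex set" and L D :: "complex \<Rightarrow> complex"
  assumes "Im t \<noteq> 0"
    and "log_branch L" and "dilog_branch D"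
    and "\<exists>v. v \<noteq> 0 \<and> l = ray v" and "l \<notin> bps_rays t"
    and "is_sector S" and "l \<subseteq> S" and "\<forall>\<rho>\<in>bps_rays t. \<not> \<rho> \<subseteq> S"
  shows "\<exists>k::real. k > 0 \<and>
    (\<forall>\<^sub>F z in at_infinity. z \<in> S \<longrightarrow>
       norm z powr (- k) < norm (X_dual L D t z) \<and>
       norm (X_dual L D t z) < norm z powr k)"
proof -
  obtain a b where b: "b \<ge> 0"
    and ab: "\<And>z. z \<in> S \<Longrightarrow> norm z \<ge> 1 \<Longrightarrow> norm (log_X_inst t z) \<le> a + b * ln (norm z)"
    using log_X_inst_bound[OF assms(1,6,8)] by metis
  define c where "c = norm (2 * of_real pi * \<i> * Z_dual L D t)"
  \<comment> \<open>the additional \<open>1\<close> absorbs the bounded factors once \<open>ln (norm z)\<close> exceeds \<open>a + c\<close>\<close>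
  define k where "k = b + 1"
  have bound: "norm z powr (- k) < norm (X_dual L D t z) \<and> norm (X_dual L D t z) < norm z powr k"
    if z: "z \<in> S" "norm z \<ge> max 1 (exp (a + c + 1))" for z
  proof -
    have z1: "norm z \<ge> 1" using z by simp
    define w where "w = 2 * of_real pi * \<i> * Z_dual L D t / z + log_X_inst t z"
    have "ln (exp (a + c + 1)) \<le> ln (norm z)" using z by (intro ln_mono) auto
    hence ln_z: "a + c < ln (norm z)" by simp
    have "norm (2 * of_real pi * \<i> * Z_dual L D t / z) \<le> c / 1"
      unfolding norm_divide c_def using z1 by (intro divide_left_mono) auto
    hence "norm w \<le> c + (a + b * ln (norm z))"
      unfolding w_def by (intro order.trans[OF norm_triangle_ineq] add_mono ab z z1) simp
    hence w: "\<bar>Re w\<bar> < k * ln (norm z)"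
      using ln_z abs_Re_le_cmod[of w] by (simp add: k_def algebra_simps)
    have X: "norm (X_dual L D t z) = exp (Re w)"
      by (simp add: X_dual_def w_def exp_add[symmetric] norm_exp_eq_Re del: exp_add)
    show ?thesis
      unfolding X powr_def using w z1 by auto
  qed
  have "\<forall>\<^sub>F z in at_infinity. z \<in> S \<longrightarrow>
       norm z powr (- k) < norm (X_dual L D t z) \<and> norm (X_dual L D t z) < norm z powr k"
    unfolding eventually_at_infinity using bound by blast
  thus ?thesis using b by (intro exI[of _ k]) (simp add: k_def)
qed

end
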